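(* Let $p,q$ be non-zero integers, let $B(p,q)=\langle a,t\mid ta^pt^{-1}=a^q\rangle$ be the Baumslag-Solitar group, and let $N$ be the kernel of its modular map $B(p,q)\to\mathbb{Q}^*$, $t\mapsto p/q$, $a\mapsto1$. Consider a free p.m.p. action of $B(p,q)$ on $(X,\mu)$. If $N$ acts strongly ergodically and all the non-trivial powers $a^k$ ($k\neq0$) of $a$ act ergodically, then the action is non-approximable.
   Context: $(X,\mu)$ is an atomless standard Borel probability space, and p.m.p. means probability measure preserving. A p.m.p. action of a countable group $\Gamma$ on $(X,\mu)$ is strongly ergodic if for every sequence $(A_n)$ of Borel subsets of $X$ with $\lim_{n\to\infty}\mu(A_n\,\Delta\,gA_n)=0$ for each $g\in\Gamma$, one has $\mu(A_n)(1-\mu(A_n))\to0$. An approximation of a standard p.m.p. equivalence relation ${\mathcal{R}}$ (Borel, with countable classes, preserving $\mu$) is an increasing sequence $({\mathcal{R}}_n)_{n\in\mathbb{N}}$ of standard (Borel) sub-equivalence relations with $\bigcup_n{\mathcal{R}}_n={\mathcal{R}}$. It is trivial if there are some $n$ and a Borel subset $A\subset X$ with $\mu(A)>0$ such that ${\mathcal{R}}_n{\upharpoonright}A={\mathcal{R}}{\upharpoonright}A$, where ${\mathcal{R}}{\upharpoonright}A={\mathcal{R}}\cap(A\times A)$. ${\mathcal{R}}$ is non-approximable if every approximation of it is trivial. An action of a countable group $G$ is non-approximable if its orbit equivalence relation $\{(x,gx):x\in X,\ g\in G\}$ is non-approximable. Equalities are understood up to null sets. *)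

theory Defs
  imports "HOL-Probability.Probability" "HOL-Algebra.Algebra"
begin

section \<open>Groups given by generators and relations\<close>

text \<open>A letter \<open>(x, True)\<close> stands for the generator \<open>x\<close> and \<open>(x, False)\<close> for its formal inverse;
  a pair \<open>(u, v)\<close> in \<open>E\<close> stands for the relation \<open>u = v\<close>.\<close>

type_synonym 'g word = "('g \<times> bool) list"

inductive pres_eq :: "('g word \<times> 'g word) set \<Rightarrow> 'g word \<Rightarrow> 'g word \<Rightarrow> bool"
  for E :: "('g word \<times> 'g word) set" where
  refl: "pres_eq E u u"
| sym: "pres_eq E u v \<Longrightarrow> pres_eq E v u"
| trans: "pres_eq E u v \<Longrightarrow> pres_eq E v w \<Longrightarrow> pres_eq E u w"
| append: "pres_eq E u u' \<Longrightarrow> pres_eq E v v' \<Longrightarrow> pres_eq E (u @ v) (u' @ v')"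
| cancel: "pres_eq E [(x, b), (x, \<not> b)] []"
| rel: "(u, v) \<in> E \<Longrightarrow> pres_eq E u v"

definition pres_class :: "('g word \<times> 'g word) set \<Rightarrow> 'g word \<Rightarrow> 'g word set" where
  "pres_class E u = {v. pres_eq E u v}"

definition presented_group :: "('g word \<times> 'g word) set \<Rightarrow> 'g word set monoid" where
  "presented_group E =
     \<lparr>carrier = range (pres_class E),
      mult = (\<lambda>U V. \<Union>u\<in>U. \<Union>v\<in>V. pres_class E (u @ v)),
      one = pres_class E []\<rparr>"

lemma pres_class_eq_iff: "pres_class E u = pres_class E v \<longleftrightarrow> pres_eq E u v"
proof
  assume "pres_class E u = pres_class E v"
  moreover have "v \<in> pres_class E v" by (simp add: pres_class_def pres_eq.refl)
  ultimately have "v \<in> pres_class E u" by simp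
  then show "pres_eq E u v" by (simp add: pres_class_def)
next
  assume "pres_eq E u v"
  then have "pres_eq E u w \<longleftrightarrow> pres_eq E v w" for w
    using pres_eq.trans pres_eq.sym by metis
  then show "pres_class E u = pres_class E v" by (simp add: pres_class_def)
qed

lemma presented_group_mult:
  "pres_class E u \<otimes>\<^bsub>presented_group E\<^esub> pres_class E v = pres_class E (u @ v)"
proof -
  have "pres_class E (u' @ v') = pres_class E (u @ v)"
    if "u' \<in> pres_class E u" "v' \<in> pres_class E v" for u' v'
    unfolding pres_class_eq_iff
    by (rule pres_eq.sym, rule pres_eq.append) (use that in \<open>simp_all add: pres_class_def\<close>)
  then have "(\<Union>u'\<in>pres_class E u. \<Union>v'\<in>pres_class E v. pres_class E (u' @ v'))
      = (\<Union>u'\<in>pres_class E u. \<Union>v'\<in>pres_class E v. pres_class E (u @ v))"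
    by (intro SUP_cong HOL.refl)
  moreover have "pres_class E u \<noteq> {}" "pres_class E v \<noteq> {}"
    using pres_eq.refl by (auto simp: pres_class_def)
  ultimately have "(\<Union>u'\<in>pres_class E u. \<Union>v'\<in>pres_class E v. pres_class E (u' @ v'))
      = pres_class E (u @ v)"
    by simp
  then show ?thesis
    by (simp add: presented_group_def)
qed

lemma pres_eq_inverse:
  "pres_eq E (map (\<lambda>(x, b). (x, \<not> b)) (rev u) @ u) []"
proof (induction u)
  case Nil
  show ?case by (simp add: pres_eq.refl)
next
  case (Cons l u)
  obtain x b where l: "l = (x, b)" by force
  let ?w = "map (\<lambda>(x, b). (x, \<not> b)) (rev u)"
  have "pres_eq E ([(x, \<not> b), (x, b)] @ u) ([] @ u)"
    using pres_eq.cancel[of E x "\<not> b"] by (intro pres_eq.append pres_eq.refl) simp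
  then have "pres_eq E (?w @ [(x, \<not> b), (x, b)] @ u) (?w @ u)"
    by (intro pres_eq.append pres_eq.refl) simp
  then have "pres_eq E (?w @ [(x, \<not> b), (x, b)] @ u) []"
    using Cons.IH by (rule pres_eq.trans)
  then show ?case
    by (simp add: l)
qed

lemma group_presented_group: "group (presented_group E)"
proof (rule groupI)
  fix g assume "g \<in> carrier (presented_group E)"
  then obtain u where u: "g = pres_class E u" by (auto simp: presented_group_def)
  show "\<exists>h\<in>carrier (presented_group E). h \<otimes>\<^bsub>presented_group E\<^esub> g = \<one>\<^bsub>presented_group E\<^esub>"
  proof (rule bexI)
    show "pres_class E (map (\<lambda>(x, b). (x, \<not> b)) (rev u)) \<otimes>\<^bsub>presented_group E\<^esub> g
        = \<one>\<^bsub>presented_group E\<^esub>"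
      unfolding u presented_group_mult by (simp add: presented_group_def pres_class_eq_iff pres_eq_inverse)
  qed (simp add: presented_group_def)
next
  fix g h assume "g \<in> carrier (presented_group E)" "h \<in> carrier (presented_group E)"
  then obtain u v where "g = pres_class E u" "h = pres_class E v"
    by (auto simp: presented_group_def)
  then show "g \<otimes>\<^bsub>presented_group E\<^esub> h \<in> carrier (presented_group E)"
    by (simp add: presented_group_mult) (simp add: presented_group_def)
next
  fix g h k assume "g \<in> carrier (presented_group E)" "h \<in> carrier (presented_group E)"
    "k \<in> carrier (presented_group E)"
  then obtain u v w where "g = pres_class E u" "h = pres_class E v" "k = pres_class E w"
    by (auto simp: presented_group_def)
  then show "g \<otimes>\<^bsub>presented_group E\<^esub> h \<otimes>\<^bsub>presented_group E\<^esub> k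
      = g \<otimes>\<^bsub>presented_group E\<^esub> (h \<otimes>\<^bsub>presented_group E\<^esub> k)"
    by (simp add: presented_group_mult)
next
  fix g assume "g \<in> carrier (presented_group E)"
  then obtain u where "g = pres_class E u" by (auto simp: presented_group_def)
  moreover have "\<one>\<^bsub>presented_group E\<^esub> = pres_class E []" by (simp add: presented_group_def)
  ultimately show "\<one>\<^bsub>presented_group E\<^esub> \<otimes>\<^bsub>presented_group E\<^esub> g = g"
    by (simp add: presented_group_mult)
qed (simp add: presented_group_def)


section \<open>Baumslag--Solitar groups and the modular map\<close>

datatype bs_gen = Gen_a | Gen_t

definition word_int_pow :: "'g \<Rightarrow> int \<Rightarrow> 'g word" where
  "word_int_pow x k = replicate (nat \<bar>k\<bar>) (x, k \<ge> 0)"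

definition bs_relations :: "int \<Rightarrow> int \<Rightarrow> (bs_gen word \<times> bs_gen word) set" where
  "bs_relations p q =
     {([(Gen_t, True)] @ word_int_pow Gen_a p @ [(Gen_t, False)], word_int_pow Gen_a q)}"

definition BS :: "int \<Rightarrow> int \<Rightarrow> bs_gen word set monoid" where
  "BS p q = presented_group (bs_relations p q)"

definition bs_a :: "int \<Rightarrow> int \<Rightarrow> bs_gen word set" where
  "bs_a p q = pres_class (bs_relations p q) [(Gen_a, True)]"

definition bs_t :: "int \<Rightarrow> int \<Rightarrow> bs_gen word set" where
  "bs_t p q = pres_class (bs_relations p q) [(Gen_t, True)]"

definition rat_units :: "rat monoid" where
  "rat_units = \<lparr>carrier = {x. x \<noteq> 0}, mult = (*), one = 1\<rparr>"

definition bs_modular_word :: "int \<Rightarrow> int \<Rightarrow> bs_gen word \<Rightarrow> rat" where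
  "bs_modular_word p q u =
     (\<Prod>(x, b)\<leftarrow>u. let r = (case x of Gen_a \<Rightarrow> 1 | Gen_t \<Rightarrow> of_int p / of_int q)
                in if b then r else inverse r)"

text \<open>For non-zero \<open>p\<close>, \<open>q\<close> the value does not depend on the word representing a group element, so the
  image below is a singleton.\<close>

definition bs_modular :: "int \<Rightarrow> int \<Rightarrow> bs_gen word set \<Rightarrow> rat" where
  "bs_modular p q g = the_elem (bs_modular_word p q ` g)"

definition bs_modular_kernel :: "int \<Rightarrow> int \<Rightarrow> bs_gen word set set" where
  "bs_modular_kernel p q = kernel (BS p q) rat_units (bs_modular p q)"

lemma bs_modular_word_append:
  "bs_modular_word p q (u @ v) = bs_modular_word p q u * bs_modular_word p q v"
  by (simp add: bs_modular_word_def)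

lemma bs_modular_word_pow_a: "bs_modular_word p q (word_int_pow Gen_a k) = 1"
  by (simp add: bs_modular_word_def word_int_pow_def map_replicate_const)

lemma bs_modular_word_cong:
  assumes "p \<noteq> 0" "q \<noteq> 0" "pres_eq (bs_relations p q) u v"
  shows "bs_modular_word p q u = bs_modular_word p q v"
  using assms(3)
proof induction
  case (cancel x b)
  then show ?case using assms(1,2) by (cases x; cases b) (auto simp: bs_modular_word_def)
next
  case (rel u v)
  then have u: "u = [(Gen_t, True)] @ word_int_pow Gen_a p @ [(Gen_t, False)]"
    and v: "v = word_int_pow Gen_a q" by (auto simp: bs_relations_def)
  show ?case unfolding u v bs_modular_word_append bs_modular_word_pow_a
    using assms(1,2) by (simp add: bs_modular_word_def)
qed (auto simp: bs_modular_word_append)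

lemma bs_modular_class:
  assumes "p \<noteq> 0" "q \<noteq> 0"
  shows "bs_modular p q (pres_class (bs_relations p q) u) = bs_modular_word p q u"
proof -
  have "bs_modular_word p q ` pres_class (bs_relations p q) u = {bs_modular_word p q u}"
    using bs_modular_word_cong[OF assms, symmetric] pres_eq.refl
    by (intro equalityI subsetI) (force simp: pres_class_def)+
  then show ?thesis by (simp add: bs_modular_def)
qed

lemma bs_modular_hom:
  assumes "p \<noteq> 0" "q \<noteq> 0"
  shows "bs_modular p q \<in> hom (BS p q) rat_units"
proof -
  have "bs_modular_word p q u \<noteq> 0" for u
    using assms by (induction u) (auto simp: bs_modular_word_def Let_def split: bs_gen.splits if_splits)
  then have ne: "bs_modular p q (pres_class (bs_relations p q) u) \<noteq> 0" for u
    by (simp add: bs_modular_class[OF assms])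
  have carrier: "carrier (BS p q) = range (pres_class (bs_relations p q))"
    by (simp add: BS_def presented_group_def)
  show ?thesis
  proof (rule homI)
    fix g assume "g \<in> carrier (BS p q)"
    then show "bs_modular p q g \<in> carrier rat_units"
      using ne by (auto simp: carrier rat_units_def)
  next
    fix g h assume "g \<in> carrier (BS p q)" "h \<in> carrier (BS p q)"
    then obtain u v where "g = pres_class (bs_relations p q) u" "h = pres_class (bs_relations p q) v"
      by (auto simp: carrier)
    then show "bs_modular p q (g \<otimes>\<^bsub>BS p q\<^esub> h)
        = bs_modular p q g \<otimes>\<^bsub>rat_units\<^esub> bs_modular p q h"
      by (simp add: BS_def presented_group_mult bs_modular_class[OF assms] bs_modular_word_append
          rat_units_def)
  qed
qed

lemma bs_modular_generators:
  assumes "p \<noteq> 0" "q \<noteq> 0"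
  shows "bs_modular p q (bs_a p q) = 1" "bs_modular p q (bs_t p q) = of_int p / of_int q"
  by (simp_all add: bs_a_def bs_t_def bs_modular_class[OF assms]) (simp_all add: bs_modular_word_def)


section \<open>Measure preserving actions\<close>

definition standard_borel :: "'x measure \<Rightarrow> bool" where
  "standard_borel M \<longleftrightarrow>
     (\<exists>T. completely_metrizable_space T \<and> second_countable T \<and> topspace T = space M \<and>
          sets M = sigma_sets (space M) {U. openin T U})"

definition atomless :: "'x measure \<Rightarrow> bool" where
  "atomless M \<longleftrightarrow>
     (\<forall>A\<in>sets M. emeasure M A > 0 \<longrightarrow>
        (\<exists>B\<in>sets M. B \<subseteq> A \<and> 0 < emeasure M B \<and> emeasure M B < emeasure M A))"

definition pmp_action :: "('g, 'b) monoid_scheme \<Rightarrow> 'x measure \<Rightarrow> ('g \<Rightarrow> 'x \<Rightarrow> 'x) \<Rightarrow> bool" where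
  "pmp_action G M \<phi> \<longleftrightarrow>
     group_action G (space M) \<phi> \<and>
     (\<forall>g\<in>carrier G. \<phi> g \<in> measurable M M \<and> distr M M (\<phi> g) = M)"

definition free_action :: "('g, 'b) monoid_scheme \<Rightarrow> 'x measure \<Rightarrow> ('g \<Rightarrow> 'x \<Rightarrow> 'x) \<Rightarrow> bool" where
  "free_action G M \<phi> \<longleftrightarrow> (AE x in M. stabilizer G \<phi> x = {\<one>\<^bsub>G\<^esub>})"

definition ergodic_action :: "('g, 'b) monoid_scheme \<Rightarrow> 'x measure \<Rightarrow> ('g \<Rightarrow> 'x \<Rightarrow> 'x) \<Rightarrow> bool" where
  "ergodic_action G M \<phi> \<longleftrightarrow>
     (\<forall>A\<in>sets M. (\<forall>g\<in>carrier G. measure M (sym_diff A (\<phi> g ` A)) = 0) \<longrightarrow>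
        measure M A = 0 \<or> measure M A = 1)"

definition strongly_ergodic_action ::
    "('g, 'b) monoid_scheme \<Rightarrow> 'x measure \<Rightarrow> ('g \<Rightarrow> 'x \<Rightarrow> 'x) \<Rightarrow> bool" where
  "strongly_ergodic_action G M \<phi> \<longleftrightarrow>
     (\<forall>A :: nat \<Rightarrow> 'x set. (\<forall>n. A n \<in> sets M) \<longrightarrow>
        (\<forall>g\<in>carrier G. (\<lambda>n. measure M (sym_diff (A n) (\<phi> g ` A n))) \<longlonglongrightarrow> 0) \<longrightarrow>
        (\<lambda>n. measure M (A n) * (1 - measure M (A n))) \<longlonglongrightarrow> 0)"


section \<open>Measured equivalence relations and approximations\<close>

definition pmp_equiv_rel :: "'x measure \<Rightarrow> ('x \<times> 'x) set \<Rightarrow> bool" where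
  "pmp_equiv_rel M R \<longleftrightarrow>
     equiv (space M) R \<and> R \<in> sets (M \<Otimes>\<^sub>M M) \<and>
     (\<forall>x\<in>space M. countable (R `` {x})) \<and>
     (\<forall>A\<in>sets M. \<forall>B\<in>sets M. \<forall>f.
        bij_betw f A B \<and>
        f \<in> measurable (restrict_space M A) (restrict_space M B) \<and>
        inv_into A f \<in> measurable (restrict_space M B) (restrict_space M A) \<and>
        (\<forall>x\<in>A. (x, f x) \<in> R) \<longrightarrow>
        emeasure M A = emeasure M B)"

text \<open>The inclusions and the equality of relations are required on a conull set \<open>Y\<close> only; since countably
  many null sets may be discarded at once, a single \<open>Y\<close> serves for all of them. That the \<open>R n\<close> are
  (mod null) contained in \<open>S\<close> is part of the last equality.\<close>

definition approximation :: "'x measure \<Rightarrow> ('x \<times> 'x) set \<Rightarrow> (nat \<Rightarrow> ('x \<times> 'x) set) \<Rightarrow> bool" where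
  "approximation M S R \<longleftrightarrow>
     (\<forall>n. pmp_equiv_rel M (R n)) \<and>
     (\<exists>Y\<in>sets M. space M - Y \<in> null_sets M \<and>
        (\<forall>n. Restr (R n) Y \<subseteq> Restr (R (Suc n)) Y) \<and>
        (\<Union>n. Restr (R n) Y) = Restr S Y)"

text \<open>Here an equality mod null may be taken literally, by removing a null set from \<open>A\<close>.\<close>

definition trivial_approximation ::
    "'x measure \<Rightarrow> ('x \<times> 'x) set \<Rightarrow> (nat \<Rightarrow> ('x \<times> 'x) set) \<Rightarrow> bool" where
  "trivial_approximation M S R \<longleftrightarrow>
     (\<exists>n. \<exists>A\<in>sets M. emeasure M A > 0 \<and> Restr (R n) A = Restr S A)"

definition non_approximable :: "'x measure \<Rightarrow> ('x \<times> 'x) set \<Rightarrow> bool" where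
  "non_approximable M S \<longleftrightarrow> (\<forall>R. approximation M S R \<longrightarrow> trivial_approximation M S R)"

definition orbit_equiv_rel ::
    "('g, 'b) monoid_scheme \<Rightarrow> 'x measure \<Rightarrow> ('g \<Rightarrow> 'x \<Rightarrow> 'x) \<Rightarrow> ('x \<times> 'x) set" where
  "orbit_equiv_rel G M \<phi> = {(x, \<phi> g x) | x g. x \<in> space M \<and> g \<in> carrier G}"

definition non_approximable_action ::
    "('g, 'b) monoid_scheme \<Rightarrow> 'x measure \<Rightarrow> ('g \<Rightarrow> 'x \<Rightarrow> 'x) \<Rightarrow> bool" where
  "non_approximable_action G M \<phi> \<longleftrightarrow> non_approximable M (orbit_equiv_rel G M \<phi>)"

end

theory Submission
  imports Defs
begin

text \<open>Let \<open>R\<close> be an approximation of the orbit relation and let \<open>gap (R n) g\<close> be the measure of the set of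
  \<open>x\<close> with \<open>(x, g x) \<notin> R n\<close>; it tends to \<open>0\<close> for each \<open>g\<close>. Every element of \<open>N\<close> commutes with a
  power of \<open>a\<close>. If \<open>g\<close> commutes with \<open>h\<close>, then the set of \<open>x\<close> with \<open>(x, h x) \<in> R n\<close> is nearly
  \<open>g\<close>-invariant, with an error that does not depend on \<open>h\<close>. Strong ergodicity needs only finitely
  many \<open>g \<in> N\<close>, so it yields \<open>b = a\<^sup>k\<close> such that, for large \<open>n\<close>, each \<open>gap (R n) (b\<^sup>i)\<close> is near
  \<open>0\<close> or \<open>1\<close>; as \<open>gap (R n) b\<close> is small, \<open>gap (R n) (b\<^sup>i)\<close> is small for all \<open>i\<close> at once.

  Hence most points are related to most of their \<open>b\<close>-orbit, and there is a large set \<open>A\<close> such that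
  points of \<open>A\<close> in the same \<open>b\<close>-orbit are \<open>R n\<close>-related. Every \<open>g\<close> in the group satisfies
  \<open>g b\<^sup>m = b\<^sup>l g\<close> for some non-zero \<open>m\<close>, \<open>l\<close>, so ergodicity of \<open>b\<^sup>m\<close> shows that, among the \<open>x \<in> A\<close>
  with \<open>g x \<in> A\<close>, either almost all or almost none satisfy \<open>(x, g x) \<in> R n\<close>. The elements \<open>g\<close> of the
  first kind form a subgroup, which contains the generators when \<open>n\<close> is large. Off a null set,
  \<open>R n\<close> therefore coincides with the orbit relation on \<open>A\<close>.\<close>

section \<open>Cluster points of restricted measures\<close>

text \<open>A substitute for a weak limit of the indicator functions of the \<open>A k\<close>. The
  set functions \<open>C \<mapsto> measure M (A k \<inter> C)\<close> lie in a product of compact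
  intervals, so by Tychonoff they have a pointwise cluster point. The product has a factor for every
  set, hence a filter \<open>F\<close> instead of a subsequence.\<close>

lemma (in finite_measure) ex_cluster_measure:
  fixes A :: "nat \<Rightarrow> 'a set"
  assumes [measurable]: "\<And>k. A k \<in> sets M"
  obtains N F where "finite_measure N" "sets N = sets M" "F \<noteq> bot" "F \<le> sequentially"
    "\<And>C. C \<in> sets M \<Longrightarrow> ((\<lambda>k. measure M (A k \<inter> C)) \<longlongrightarrow> measure N C) F"
proof -
  define s where "s = (\<lambda>k C. measure M (A k \<inter> C))"
  let ?P = "PiE UNIV (\<lambda>_ :: 'a set. {0..measure M (space M)})"
  have "compactin (product_topology (\<lambda>_. euclidean) UNIV) ?P"
    by (subst compactin_PiE) auto
  then have "compact ?P"
    by (simp add: euclidean_product_topology)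
  moreover have "eventually (\<lambda>f. f \<in> ?P) (filtermap s sequentially)"
    by (auto simp: eventually_filtermap s_def bounded_measure intro!: always_eventually)
  ultimately obtain l where l: "inf (nhds l) (filtermap s sequentially) \<noteq> bot"
    unfolding compact_filter by (metis filtermap_bot_iff sequentially_bot)
  \<comment> \<open>Since \<open>F\<close> is finer than the pullback of \<open>nhds l\<close>,
    \<open>s\<close> converges to \<open>l\<close> along \<open>F\<close> by construction; that
    \<open>l\<close> is a cluster point keeps \<open>F\<close> proper.\<close>
  define F where "F = inf (filtercomap s (nhds l)) sequentially"
  have F: "F \<noteq> bot" "F \<le> sequentially"
  proof -
    show "F \<noteq> bot"
    proof
      assume "F = bot"
      then have "eventually (\<lambda>_. False) F" by simp
      then obtain P Q where PQ: "eventually P (nhds l)" "eventually Q sequentially"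
        "\<And>k. P (s k) \<Longrightarrow> Q k \<Longrightarrow> False"
        unfolding F_def eventually_inf eventually_filtercomap by blast
      have "eventually (\<lambda>f. \<not> P f) (filtermap s sequentially)"
        unfolding eventually_filtermap using PQ(2) by eventually_elim (use PQ(3) in blast)
      then have "eventually (\<lambda>_. False) (inf (nhds l) (filtermap s sequentially))"
        unfolding eventually_inf using PQ(1) by (metis (no_types, lifting))
      then show False using l by (simp add: eventually_False)
    qed
  qed (simp add: F_def)
  have lim: "((\<lambda>k. measure M (A k \<inter> C)) \<longlongrightarrow> l C) F" for C
  proof -
    have "(s \<longlongrightarrow> l) F"
      by (simp add: F_def filterlim_iff_le_filtercomap)
    then have "((\<lambda>k. s k C) \<longlongrightarrow> l C) F"
      using continuous_on_tendsto_compose[OF continuous_on_product_coordinates[of C], of s l F]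
      by simp
    then show ?thesis by (simp add: s_def)
  qed
  have l0: "0 \<le> l C" for C
    by (rule tendsto_lowerbound[OF lim _ F(1)]) simp
  have l_le: "l C \<le> measure M C" if "C \<in> sets M" for C
    by (rule tendsto_upperbound[OF lim _ F(1)]) (use that in \<open>auto intro!: always_eventually finite_measure_mono\<close>)
  have l_Un: "l (C \<union> D) = l C + l D" if "C \<in> sets M" "D \<in> sets M" "C \<inter> D = {}" for C D
  proof (rule tendsto_unique[OF F(1) lim])
    have "measure M (A k \<inter> (C \<union> D)) = measure M (A k \<inter> C) + measure M (A k \<inter> D)" for k
      using that by (subst finite_measure_Union[symmetric]) (auto simp: Int_Un_distrib)
    then show "((\<lambda>k. measure M (A k \<inter> (C \<union> D))) \<longlongrightarrow> l C + l D) F"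
      using tendsto_add[OF lim lim] by simp
  qed
  define N where "N = measure_of (space M) (sets M) (\<lambda>C. ennreal (l C))"
  have pos: "positive (sets M) (\<lambda>C. ennreal (l C))"
    using l_le[of "{}"] l0[of "{}"] by (simp add: positive_def)
  \<comment> \<open>Finite additivity passes to the limit, and the bound of \<open>l\<close> by
    \<open>measure M\<close> transfers continuity at the empty set.\<close>
  have "countably_additive (sets M) (\<lambda>C. ennreal (l C))"
  proof (rule sets.empty_continuous_imp_countably_additive[OF pos])
    show "additive (sets M) (\<lambda>C. ennreal (l C))"
      by (auto simp: additive_def l_Un l0 ennreal_plus[symmetric] simp del: ennreal_plus)
    fix B :: "nat \<Rightarrow> 'a set" assume B: "range B \<subseteq> sets M" "decseq B" "(\<Inter>i. B i) = {}"
    have "(\<lambda>i. measure M (B i)) \<longlonglongrightarrow> measure M (\<Inter>i. B i)"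
      by (rule finite_Lim_measure_decseq) (use B in auto)
    then have 1: "(\<lambda>i. measure M (B i)) \<longlonglongrightarrow> 0"
      by (simp add: B)
    have "(\<lambda>i. l (B i)) \<longlonglongrightarrow> 0"
      by (rule tendsto_sandwich[OF _ _ tendsto_const 1])
        (use B l_le l0 in \<open>auto intro!: always_eventually\<close>)
    then show "(\<lambda>i. ennreal (l (B i))) \<longlonglongrightarrow> 0"
      using tendsto_ennrealI by fastforce
  qed simp
  then have em: "emeasure N C = ennreal (l C)" if "C \<in> sets M" for C
    using that unfolding N_def by (intro emeasure_measure_of_sigma pos) (auto intro: sets.sigma_algebra_axioms)
  have sets: "sets N = sets M" by (simp add: N_def)
  have me: "measure N C = l C" if "C \<in> sets M" for C
    using em[OF that] l0 by (simp add: measure_def)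
  show thesis
  proof
    show "finite_measure N"
      using em[OF sets.top] sets_eq_imp_space_eq[OF sets] by (intro finite_measureI) simp
  qed (use F lim me sets in auto)
qed

section \<open>Sub-equivalence relations of an action\<close>

locale pmp_group_action = prob_space M + group G
  for M :: "'x measure" and G :: "('g, 'm) monoid_scheme" (structure) +
  fixes \<phi> :: "'g \<Rightarrow> 'x \<Rightarrow> 'x"
  assumes pmp: "pmp_action G M \<phi>"
begin

lemma group_action: "group_action G (space M) \<phi>"
  using pmp by (simp add: pmp_action_def)

lemma act_measurable [measurable]: "g \<in> carrier G \<Longrightarrow> \<phi> g \<in> measurable M M"
  using pmp by (simp add: pmp_action_def)

lemma act_space [simp]: "g \<in> carrier G \<Longrightarrow> x \<in> space M \<Longrightarrow> \<phi> g x \<in> space M"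
  using act_measurable by (rule measurable_space)

lemma act_mult: "g \<in> carrier G \<Longrightarrow> h \<in> carrier G \<Longrightarrow> x \<in> space M \<Longrightarrow> \<phi> (g \<otimes> h) x = \<phi> g (\<phi> h x)"
  using group_action.composition_rule[OF group_action] by blast

lemma act_one [simp]: "x \<in> space M \<Longrightarrow> \<phi> \<one> x = x"
  using group_action.id_eq_one[OF group_action] by (metis restrict_apply')

lemma act_inv [simp]:
  assumes "g \<in> carrier G" "x \<in> space M"
  shows "\<phi> (inv g) (\<phi> g x) = x" "\<phi> g (\<phi> (inv g) x) = x"
  using assms by (simp_all flip: act_mult)

text \<open>Ergodicity is phrased with images, whereas measurability and invariance of the measure
  are available for preimages.\<close>

lemma act_image_eq_vimage:
  assumes "g \<in> carrier G" "A \<subseteq> space M"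
  shows "\<phi> g ` A = \<phi> (inv g) -` A \<inter> space M"
proof (intro equalityI subsetI)
  fix y assume "y \<in> \<phi> (inv g) -` A \<inter> space M"
  then show "y \<in> \<phi> g ` A"
    using assms by (metis IntD1 IntD2 act_inv(2) imageI vimageD)
qed (use assms in auto)

lemma act_image_sets [measurable]:
  assumes "g \<in> carrier G" "A \<in> sets M"
  shows "\<phi> g ` A \<in> sets M"
  using assms by (simp add: act_image_eq_vimage sets.sets_into_space)

lemma measure_act_vimage [simp]:
  assumes "g \<in> carrier G" "A \<in> sets M"
  shows "measure M (\<phi> g -` A \<inter> space M) = measure M A"
proof -
  have "distr M M (\<phi> g) = M"
    using pmp assms by (simp add: pmp_action_def)
  then show ?thesis
    using measure_distr[OF act_measurable[OF assms(1)] assms(2)] by simp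
qed

lemma measure_act_image [simp]:
  assumes "g \<in> carrier G" "A \<in> sets M"
  shows "measure M (\<phi> g ` A) = measure M A"
  using assms by (simp add: act_image_eq_vimage sets.sets_into_space)

definition linked :: "('x \<times> 'x) set \<Rightarrow> 'g \<Rightarrow> 'x set" where
  "linked r g = {x \<in> space M. (x, \<phi> g x) \<in> r}"

definition gap :: "('x \<times> 'x) set \<Rightarrow> 'g \<Rightarrow> real" where
  "gap r g = measure M (space M - linked r g)"

end

locale measurable_equiv_action = pmp_group_action M G \<phi>
  for M :: "'x measure" and G :: "('g, 'm) monoid_scheme" (structure) and \<phi> :: "'g \<Rightarrow> 'x \<Rightarrow> 'x" +
  fixes r :: "('x \<times> 'x) set"
  assumes equiv: "equiv (space M) r" and r_sets: "r \<in> sets (M \<Otimes>\<^sub>M M)"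
begin

lemma r_refl: "x \<in> space M \<Longrightarrow> (x, x) \<in> r"
  using equiv by (auto simp: equiv_def refl_on_def)

lemma r_sym: "(x, y) \<in> r \<Longrightarrow> (y, x) \<in> r"
  using equiv by (auto simp: equiv_def sym_def)

lemma r_trans: "(x, y) \<in> r \<Longrightarrow> (y, z) \<in> r \<Longrightarrow> (x, z) \<in> r"
  using equiv unfolding equiv_def trans_def by blast

lemma linked_sets [measurable]:
  assumes [measurable]: "g \<in> carrier G"
  shows "linked r g \<in> sets M"
proof -
  have "(\<lambda>x. (x, \<phi> g x)) -` r \<inter> space M \<in> sets M"
    using r_sets by (intro measurable_sets[where A = "M \<Otimes>\<^sub>M M"]) measurable
  then show ?thesis
    by (simp add: linked_def vimage_def Int_def conj_commute)
qed

lemma linked_subset_space: "linked r g \<subseteq> space M"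
  by (auto simp: linked_def)

lemma gap_eq: "g \<in> carrier G \<Longrightarrow> gap r g = 1 - measure M (linked r g)"
  unfolding gap_def by (simp add: prob_compl)

lemma gap_inv:
  assumes "g \<in> carrier G"
  shows "gap r (inv g) = gap r g"
proof -
  have "linked r (inv g) = \<phi> (inv g) -` linked r g \<inter> space M"
    using assms r_sym by (auto simp: linked_def)
  then show ?thesis
    using assms by (simp add: gap_eq)
qed

text \<open>The product can leave the class of \<open>x\<close> only if \<open>h\<close> does so at
  \<open>x\<close> or \<open>g\<close> does so at \<open>h x\<close>. With \<open>gap_inv\<close>
  and \<open>gap_one\<close>, \<open>gap r\<close> is thus a pseudo-length function on the
  group.\<close>

lemma gap_mult:
  assumes [measurable]: "g \<in> carrier G" "h \<in> carrier G"
  shows "gap r (g \<otimes> h) \<le> gap r g + gap r h"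
proof -
  let ?E = "\<lambda>g. space M - linked r g"
  have "?E (g \<otimes> h) \<subseteq> ?E h \<union> (\<phi> h -` ?E g \<inter> space M)"
    using assms r_trans by (auto simp: linked_def act_mult)
  then have "gap r (g \<otimes> h) \<le> measure M (?E h \<union> (\<phi> h -` ?E g \<inter> space M))"
    unfolding gap_def by (intro finite_measure_mono) auto
  also have "\<dots> \<le> gap r h + measure M (\<phi> h -` ?E g \<inter> space M)"
    unfolding gap_def by (intro measure_Un_le) auto
  finally show ?thesis
    using assms by (simp add: gap_def)
qed

lemma gap_one: "gap r \<one> = 0"
proof -
  have "linked r \<one> = space M"
    by (auto simp: linked_def r_refl)
  then show ?thesis by (simp add: gap_def)
qed

text \<open>If \<open>x\<close> is related to \<open>h x\<close>, \<open>x\<close> to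
  \<open>g x\<close>, and \<open>h x\<close> to \<open>g (h x) = h (g x)\<close>, then
  \<open>g x\<close> is related to \<open>h (g x)\<close>. So invariance fails only where
  \<open>g\<close> moves \<open>x\<close> or \<open>h x\<close> out of its class, and each of these
  events has measure \<open>gap r g\<close>, whatever \<open>h\<close> is.\<close>

lemma measure_sym_diff_act_linked:
  assumes [measurable]: "g \<in> carrier G" "h \<in> carrier G" and comm: "g \<otimes> h = h \<otimes> g"
  shows "measure M (sym_diff (linked r h) (\<phi> g ` linked r h)) \<le> 4 * gap r g"
proof -
  let ?L = "linked r h" and ?E = "space M - linked r g"
  have gL [measurable]: "\<phi> g ` ?L \<in> sets M" by measurable
  have "\<phi> g ` ?L - ?L \<subseteq> \<phi> g ` (?E \<union> (\<phi> h -` ?E \<inter> space M))"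
  proof
    fix y assume y: "y \<in> \<phi> g ` ?L - ?L"
    then obtain x where x: "x \<in> ?L" "y = \<phi> g x" by auto
    then have xs: "x \<in> space M" and xh: "(x, \<phi> h x) \<in> r" by (auto simp: linked_def)
    have gh: "\<phi> g (\<phi> h x) = \<phi> h y"
      using comm xs x(2) assms by (simp flip: act_mult)
    have "(\<phi> g x, \<phi> h y) \<notin> r"
      using y x xs assms by (auto simp: linked_def)
    then have "(x, \<phi> g x) \<notin> r \<or> (\<phi> h x, \<phi> g (\<phi> h x)) \<notin> r"
      unfolding gh using xh r_sym r_trans by blast
    then have "x \<in> ?E \<union> (\<phi> h -` ?E \<inter> space M)"
      using xs assms by (auto simp: linked_def)
    then show "y \<in> \<phi> g ` (?E \<union> (\<phi> h -` ?E \<inter> space M))"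
      using x(2) by blast
  qed
  then have "measure M (\<phi> g ` ?L - ?L) \<le> measure M (\<phi> g ` (?E \<union> (\<phi> h -` ?E \<inter> space M)))"
    by (intro finite_measure_mono) measurable
  also have "\<dots> = measure M (?E \<union> (\<phi> h -` ?E \<inter> space M))"
    by (rule measure_act_image) measurable
  also have "\<dots> \<le> measure M ?E + measure M (\<phi> h -` ?E \<inter> space M)"
    by (rule measure_Un_le) measurable
  also have "\<dots> = 2 * gap r g"
    using assms by (simp add: gap_def)
  finally have 1: "measure M (\<phi> g ` ?L - ?L) \<le> 2 * gap r g" .
  \<comment> \<open>The linked set and its image have equal measure, hence so do the two halves of
    the symmetric difference; this doubles the bound.\<close>
  have "measure M (?L - \<phi> g ` ?L) = measure M ?L - measure M (?L \<inter> \<phi> g ` ?L)"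
    by (rule finite_measure_Diff') measurable
  moreover have "measure M (\<phi> g ` ?L - ?L) = measure M (\<phi> g ` ?L) - measure M (\<phi> g ` ?L \<inter> ?L)"
    by (rule finite_measure_Diff') measurable
  ultimately have "measure M (?L - \<phi> g ` ?L) = measure M (\<phi> g ` ?L - ?L)"
    using assms by (simp add: Int_commute)
  moreover have "measure M (sym_diff ?L (\<phi> g ` ?L)) \<le> measure M (?L - \<phi> g ` ?L) + measure M (\<phi> g ` ?L - ?L)"
    by (rule measure_Un_le) measurable
  ultimately show ?thesis using 1 by linarith
qed

end

section \<open>Powers of a single group element\<close>

lemma (in group) intertwine_int_pow:
  assumes [simp]: "g \<in> carrier G" "x \<in> carrier G" "y \<in> carrier G" and comm: "g \<otimes> x = y \<otimes> g"
  shows "g \<otimes> x [^] (i :: int) = y [^] i \<otimes> g"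
proof -
  have "g \<otimes> inv x = inv y \<otimes> (y \<otimes> g) \<otimes> inv x"
    by (simp add: m_assoc[symmetric])
  also have "\<dots> = inv y \<otimes> g"
    by (simp flip: comm add: m_assoc)
  finally have inv: "g \<otimes> inv x = inv y \<otimes> g" .
  have nat: "g \<otimes> u [^] n = v [^] n \<otimes> g"
    if "g \<otimes> u = v \<otimes> g" "u \<in> carrier G" "v \<in> carrier G" for u v and n :: nat
  proof (induction n)
    case (Suc n)
    have "g \<otimes> u [^] Suc n = (g \<otimes> u [^] n) \<otimes> u"
      using that by (simp add: m_assoc)
    also have "\<dots> = v [^] n \<otimes> (g \<otimes> u)"
      unfolding Suc.IH using that by (simp add: m_assoc)
    also have "\<dots> = v [^] Suc n \<otimes> g"
      unfolding that(1) using that(2,3) by (simp add: m_assoc)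
    finally show ?case .
  qed simp
  show ?thesis
  proof (cases "0 \<le> i")
    case True
    then show ?thesis
      using nat[OF comm assms(2,3), of "nat i"] by (simp add: pow_nat)
  next
    case False
    then show ?thesis
      using nat[OF inv inv_closed inv_closed, OF assms(2,3), of "nat (- i)"]
      by (simp add: pow_nat int_pow_inv int_pow_neg)
  qed
qed

context measurable_equiv_action
begin

text \<open>Let \<open>A K\<close> consist of the points that are related to more than three quarters of
  \<open>x, b x, \<dots>, b\<^sup>K\<^sup>-\<^sup>1 x\<close>. For \<open>K\<close> large compared with \<open>j\<close>, the windows of \<open>x\<close> and \<open>b\<^sup>j x\<close> overlap
  so much that these two points are related if both belong to \<open>A K\<close>. The sets \<open>A K\<close> need not
  converge, but the measures \<open>C \<mapsto> \<mu> (A K \<inter> C)\<close> have a cluster point \<open>N\<close>. On a set where \<open>N\<close> has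
  density at least \<open>2/3 > 1/2\<close> the property survives in the limit.\<close>

lemma ex_large_powers_linked:
  assumes b [measurable, simp]: "b \<in> carrier G" and gap: "\<And>i :: int. gap r (b [^] i) \<le> \<epsilon>"
  obtains A where "A \<in> sets M" "measure M A \<ge> 1 - 12 * \<epsilon>"
    "\<And>x i. x \<in> A \<Longrightarrow> \<phi> (b [^] (i :: int)) x \<in> A \<Longrightarrow> (x, \<phi> (b [^] i) x) \<in> r"
proof -
  define c :: "nat \<Rightarrow> 'x \<Rightarrow> real" where
    "c K x = (\<Sum>i\<in>{0..<int K}. indicator (linked r (b [^] i)) x)" for K x
  have c_card: "c K x = card {i\<in>{0..<int K}. x \<in> linked r (b [^] i)}" for K x
    by (simp add: c_def indicator_def sum.If_cases Int_def)
  have [measurable]: "c K \<in> borel_measurable M" for K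
    unfolding c_def by measurable
  define A where "A K = {x \<in> space M. 3 * real K / 4 < c K x}" for K
  have [measurable]: "A K \<in> sets M" for K
    unfolding A_def by measurable
  \<comment> \<open>Markov's inequality for the number of failures \<open>K - c K x\<close>: its
    mean is at most \<open>K * \<epsilon>\<close>, and outside \<open>A K\<close> it is at least
    \<open>K / 4\<close>.\<close>
  have A_large: "measure M (A K) \<ge> 1 - 4 * \<epsilon>" if "K > 0" for K
  proof -
    have int_L: "integrable M (indicat_real (linked r (b [^] i)))" for i :: int
      by (intro integrable_real_indicator) (auto simp: emeasure_eq_measure)
    then have int_c: "integrable M (c K)"
      unfolding c_def by (intro Bochner_Integration.integrable_sum)
    have "(\<integral>x. c K x \<partial>M) = (\<Sum>i\<in>{0..<int K}. measure M (linked r (b [^] i)))"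
      unfolding c_def by (subst Bochner_Integration.integral_sum[OF int_L]) simp
    also have "\<dots> \<ge> (\<Sum>i\<in>{0..<int K}. 1 - \<epsilon>)"
      using gap by (intro sum_mono) (simp add: gap_eq algebra_simps)
    finally have c_int: "(\<integral>x. c K x \<partial>M) \<ge> real K * (1 - \<epsilon>)" by simp
    have c_le: "c K x \<le> real K" for x
    proof -
      have "card {i\<in>{0..<int K}. x \<in> linked r (b [^] i)} \<le> card {0..<int K}"
        by (rule card_mono) auto
      then show ?thesis by (simp add: c_card)
    qed
    have "space M - A K = {x \<in> space M. real K / 4 \<le> real K - c K x}"
      by (auto simp: A_def)
    moreover have "measure M {x \<in> space M. real K / 4 \<le> real K - c K x} \<le> (\<integral>x. real K - c K x \<partial>M) / (real K / 4)"
      by (rule integral_Markov_inequality_measure[where A = "{}"]) (use int_c c_le that in auto)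
    ultimately have "measure M (space M - A K) \<le> (\<integral>x. real K - c K x \<partial>M) / (real K / 4)"
      by simp
    also have "(\<integral>x. real K - c K x \<partial>M) = real K - (\<integral>x. c K x \<partial>M)"
      using int_c by (simp add: prob_space)
    also have "(real K - (\<integral>x. c K x \<partial>M)) / (real K / 4) \<le> (real K * \<epsilon>) / (real K / 4)"
      using c_int that by (intro divide_right_mono) (auto simp: algebra_simps)
    also have "\<dots> = 4 * \<epsilon>" using that by simp
    finally show ?thesis by (simp add: prob_compl)
  qed
  \<comment> \<open>If \<open>x\<close> and \<open>b^j x\<close> were unrelated, \<open>I\<close>
    and the translate of \<open>J\<close> by \<open>j\<close> would be disjoint subsets of a window
    of length \<open>K + |j| < 3 K / 2\<close>, although each has more than \<open>3 K / 4\<close>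
    elements.\<close>
  have A_linked: "(x, \<phi> (b [^] j) x) \<in> r"
    if x: "x \<in> A K" and y: "\<phi> (b [^] j) x \<in> A K" and K: "2 * \<bar>j\<bar> < int K" for x K and j :: int
  proof (rule ccontr)
    assume neg: "(x, \<phi> (b [^] j) x) \<notin> r"
    have xs: "x \<in> space M" using x by (simp add: A_def)
    define I where "I = {i\<in>{0..<int K}. x \<in> linked r (b [^] i)}"
    define J where "J = {i\<in>{0..<int K}. \<phi> (b [^] j) x \<in> linked r (b [^] i)}"
    have sub: "I \<subseteq> {0..<int K}" "J \<subseteq> {0..<int K}"
      by (auto simp: I_def J_def)
    then have fin: "finite I" "finite J"
      by (auto intro: finite_subset)
    have "I \<inter> (\<lambda>i. i + j) ` J = {}"
    proof -
      have False if "i \<in> J" "i + j \<in> I" for i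
      proof -
        have "(\<phi> (b [^] j) x, \<phi> (b [^] (i + j)) x) \<in> r" "(x, \<phi> (b [^] (i + j)) x) \<in> r"
          using that xs by (auto simp: I_def J_def linked_def act_mult int_pow_mult)
        then show False using neg r_sym r_trans by blast
      qed
      then show ?thesis by blast
    qed
    then have "card I + card J = card (I \<union> (\<lambda>i. i + j) ` J)"
      using fin by (subst card_Un_disjoint) (auto simp: card_image)
    also have "\<dots> \<le> card {min 0 j..<max (int K) (int K + j)}"
      using sub by (intro card_mono) fastforce+
    also have "\<dots> = nat (int K + \<bar>j\<bar>)"
      by (simp add: min_def max_def)
    finally have "real (card I) + real (card J) \<le> real K + of_int \<bar>j\<bar>"
      by linarith
    moreover have "3 * real K / 4 < real (card I)" "3 * real K / 4 < real (card J)"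
      using x y by (auto simp: A_def c_card I_def J_def)
    moreover have "2 * of_int \<bar>j\<bar> < real K" using K by linarith
    ultimately show False by linarith
  qed
  obtain N F where N: "finite_measure N" "sets N = sets M" and F: "F \<noteq> bot" "F \<le> sequentially"
    and lim: "\<And>C. C \<in> sets M \<Longrightarrow> ((\<lambda>k. measure M (A k \<inter> C)) \<longlongrightarrow> measure N C) F"
    by (rule ex_cluster_measure[of A]) auto
  interpret N: finite_measure N by fact
  have ev_F: "eventually P F" if "eventually P sequentially" for P
    using F(2) that by (rule filter_leD)
  have N_le: "measure N C \<le> measure M C" if "C \<in> sets M" for C
    by (rule tendsto_upperbound[OF lim[OF that] _ F(1)])
      (use that in \<open>auto intro!: always_eventually finite_measure_mono\<close>)
  have N_space: "measure N (space M) \<ge> 1 - 4 * \<epsilon>"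
  proof (rule tendsto_lowerbound[OF lim _ F(1)])
    have "A k \<inter> space M = A k" for k by (auto simp: A_def)
    then have "1 - 4 * \<epsilon> \<le> measure M (A k \<inter> space M)" if "0 < k" for k
      using A_large[OF that] by simp
    then show "\<forall>\<^sub>F k in F. 1 - 4 * \<epsilon> \<le> measure M (A k \<inter> space M)"
      by (intro ev_F eventually_mono[OF eventually_gt_at_top[of 0]])
  qed simp
  \<comment> \<open>The Hahn decomposition for \<open>N\<close> and \<open>M'\<close> yields the set
    \<open>Y\<close> where \<open>N\<close> has density at least \<open>2 / 3\<close> with respect
    to \<open>M\<close>.\<close>
  define M' where "M' = scale_measure (ennreal (2 / 3)) M"
  have "finite_measure M'"
    unfolding M'_def by (intro finite_measureI) (simp add: emeasure_eq_measure ennreal_mult_eq_top_iff)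
  from finite_unsigned_Hahn_decomposition[OF N(1) this]
  obtain Y where [measurable]: "Y \<in> sets M" and
    Y: "\<And>C. C \<in> sets M \<Longrightarrow> C \<subseteq> Y \<Longrightarrow> emeasure M' C \<le> emeasure N C" and
    nY: "\<And>C. C \<in> sets M \<Longrightarrow> C \<inter> Y = {} \<Longrightarrow> emeasure N C \<le> emeasure M' C"
    using N(2) by (auto simp: M'_def)
  have em: "emeasure M' C = ennreal (2 / 3 * measure M C)" if "C \<in> sets M" for C
    using that by (simp add: M'_def emeasure_eq_measure flip: ennreal_mult)
  have Y': "2 / 3 * measure M C \<le> measure N C" if "C \<in> sets M" "C \<subseteq> Y" for C
    using Y[OF that] unfolding em[OF that(1)] N.emeasure_eq_measure by simp
  have "measure N (space M - Y) \<le> 2 / 3 * measure M (space M - Y)"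
  proof -
    have Yc: "space M - Y \<in> sets M" "(space M - Y) \<inter> Y = {}" by auto
    from nY[OF Yc] show ?thesis
      unfolding em[OF Yc(1)] N.emeasure_eq_measure by simp
  qed
  moreover have "measure N (space M) = measure N Y + measure N (space M - Y)"
  proof -
    have "Y \<in> sets N" "space M - Y \<in> sets N" "Y \<inter> (space M - Y) = {}"
      using N(2) by auto
    from N.finite_measure_Union[OF this] show ?thesis
      using sets.sets_into_space[of Y M] by (simp add: Un_absorb1)
  qed
  \<comment> \<open>With \<open>y = measure M Y\<close> the bounds read
    \<open>1 - 4 \<epsilon> \<le> y + 2/3 (1 - y)\<close>, which is the claim.\<close>
  ultimately have Y_large: "measure M Y \<ge> 1 - 12 * \<epsilon>"
    using N_space N_le[of Y] by (simp add: prob_compl)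
  define B where "B j = {x \<in> Y. \<phi> (b [^] j) x \<in> Y \<and> x \<notin> linked r (b [^] j)}" for j :: int
  have B_eq: "B j = Y \<inter> (\<phi> (b [^] j) -` Y \<inter> space M) - linked r (b [^] j)" for j
    using sets.sets_into_space[of Y M] by (auto simp: B_def)
  have [measurable]: "B j \<in> sets M" for j
    unfolding B_eq by measurable
  have B_null: "measure M (B j) = 0" for j
  proof -
    let ?g = "b [^] j"
    have g [measurable]: "?g \<in> carrier G" by simp
    have gB [measurable]: "\<phi> ?g ` B j \<in> sets M" by measurable
    \<comment> \<open>By \<open>A_linked\<close>, no point of \<open>B j\<close> lies in
      \<open>A k\<close> together with its image, so the trace of \<open>A k\<close> on
      \<open>B j\<close> and the pulled-back trace on the image are disjoint parts of
      \<open>B j\<close>. This bounds the sum of the two \<open>N\<close>-measures by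
      \<open>measure M (B j)\<close>, while each is at least two thirds of it, as both sets lie in
      \<open>Y\<close>.\<close>
    have "measure N (B j) + measure N (\<phi> ?g ` B j) \<le> measure M (B j)"
    proof (rule tendsto_upperbound[OF tendsto_add[OF lim lim] _ F(1)])
      show "\<forall>\<^sub>F k in F. measure M (A k \<inter> B j) + measure M (A k \<inter> \<phi> ?g ` B j) \<le> measure M (B j)"
      proof (rule ev_F, rule eventually_mono[OF eventually_gt_at_top[of "nat (2 * \<bar>j\<bar>)"]])
        fix k assume k: "nat (2 * \<bar>j\<bar>) < k"
        let ?V = "\<phi> ?g -` A k \<inter> space M"
        have "A k \<inter> \<phi> ?g ` B j = \<phi> ?g ` (?V \<inter> B j)"
          using sets.sets_into_space[of "B j" M] by auto
        then have "measure M (A k \<inter> \<phi> ?g ` B j) = measure M (?V \<inter> B j)"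
          by simp
        moreover have "measure M (A k \<inter> B j) + measure M (?V \<inter> B j) = measure M ((A k \<inter> B j) \<union> (?V \<inter> B j))"
        proof (rule finite_measure_Union[symmetric])
          show "(A k \<inter> B j) \<inter> (?V \<inter> B j) = {}"
            using A_linked[of _ k j] k by (auto simp: B_def linked_def)
        qed measurable
        moreover have "\<dots> \<le> measure M (B j)"
          by (intro finite_measure_mono) auto
        ultimately show "measure M (A k \<inter> B j) + measure M (A k \<inter> \<phi> ?g ` B j) \<le> measure M (B j)"
          by simp
      qed
    qed measurable
    moreover have "2 / 3 * measure M (B j) \<le> measure N (B j)"
      by (rule Y') (auto simp: B_def)
    moreover have "2 / 3 * measure M (\<phi> ?g ` B j) \<le> measure N (\<phi> ?g ` B j)"
      by (rule Y') (measurable, auto simp: B_def)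
    moreover have "measure M (\<phi> ?g ` B j) = measure M (B j)" by simp
    ultimately show ?thesis
      using measure_nonneg[of M "B j"] by linarith
  qed
  have null: "(\<Union>j. B j) \<in> null_sets M"
    using B_null by (intro null_sets_UN) (auto simp: null_sets_def emeasure_eq_measure)
  show thesis
  proof
    show "Y - (\<Union>j. B j) \<in> sets M" by measurable
    show "measure M (Y - (\<Union>j. B j)) \<ge> 1 - 12 * \<epsilon>"
      using Y_large by (simp add: measure_Diff_null_set[OF _ null])
    fix x and i :: int assume x: "x \<in> Y - (\<Union>j. B j)" "\<phi> (b [^] i) x \<in> Y - (\<Union>j. B j)"
    then have "x \<in> linked r (b [^] i)" by (auto simp: B_def)
    then show "(x, \<phi> (b [^] i) x) \<in> r" by (simp add: linked_def)
  qed
qed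

text \<open>The saturation \<open>D\<close> of the unlinked part \<open>B\<close> under the powers
  of \<open>b^m\<close> is null or conull by ergodicity, and the linked part \<open>C\<close> is
  disjoint from it. So \<open>B\<close> is null in the first case and \<open>C\<close> in the
  second.\<close>

lemma linked_dichotomy:
  fixes m l :: int
  assumes [measurable, simp]: "g \<in> carrier G" "b \<in> carrier G" "A \<in> sets M"
    and A: "\<And>x i. x \<in> A \<Longrightarrow> \<phi> (b [^] (i :: int)) x \<in> A \<Longrightarrow> (x, \<phi> (b [^] i) x) \<in> r"
    and comm: "g \<otimes> b [^] m = b [^] l \<otimes> g"
    and erg: "ergodic_action (subgroup_generated G {b [^] m}) M \<phi>"
  shows "measure M (A \<inter> \<phi> g -` A \<inter> linked r g) = 0 \<or> measure M (A \<inter> \<phi> g -` A - linked r g) = 0"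
proof -
  let ?H = "range (\<lambda>i :: int. (b [^] m) [^] i)"
  define C where "C = A \<inter> \<phi> g -` A \<inter> linked r g"
  define B where "B = A \<inter> \<phi> g -` A - linked r g"
  have As: "A \<subseteq> space M" by (rule sets.sets_into_space) simp
  have "C = A \<inter> (\<phi> g -` A \<inter> space M) \<inter> linked r g" "B = A \<inter> (\<phi> g -` A \<inter> space M) - linked r g"
    using As by (auto simp: C_def B_def)
  then have [measurable]: "C \<in> sets M" "B \<in> sets M" by simp_all
  have Bs: "B \<subseteq> space M" using As by (auto simp: B_def)
  define D where "D = (\<Union>i :: int. \<phi> ((b [^] m) [^] i) ` B)"
  have [measurable]: "D \<in> sets M"
    unfolding D_def by (intro sets.countable_UN) (auto intro!: act_image_sets)
  have inv: "\<phi> ((b [^] m) [^] j) ` D = D" for j :: int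
  proof -
    have sub: "\<phi> ((b [^] m) [^] j) ` D \<subseteq> D" for j :: int
    proof
      fix y assume "y \<in> \<phi> ((b [^] m) [^] j) ` D"
      then obtain d where d: "y = \<phi> ((b [^] m) [^] j) d" "d \<in> D" by blast
      then obtain i :: int and x where "x \<in> B" "d = \<phi> ((b [^] m) [^] i) x"
        unfolding D_def by blast
      then have "y = \<phi> ((b [^] m) [^] (j + i)) x" "x \<in> B"
        using Bs d by (auto simp: int_pow_mult act_mult)
      then show "y \<in> D" by (auto simp: D_def)
    qed
    show ?thesis
    proof (rule equalityI[OF sub])
      show "D \<subseteq> \<phi> ((b [^] m) [^] j) ` D"
      proof
        fix y assume y: "y \<in> D"
        have "D \<subseteq> space M" by (rule sets.sets_into_space) simp
        then have "y = \<phi> ((b [^] m) [^] j) (\<phi> ((b [^] m) [^] (- j)) y)"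
          using y by (subst int_pow_neg) auto
        then show "y \<in> \<phi> ((b [^] m) [^] j) ` D"
          using sub[of "- j"] y by blast
      qed
    qed
  qed
  have "measure M D = 0 \<or> measure M D = 1"
    using erg inv unfolding ergodic_action_def
    by (auto simp: carrier_subgroup_generated_by_singleton)
  moreover have "B \<subseteq> D"
  proof
    fix x assume "x \<in> B"
    then have "x = \<phi> ((b [^] m) [^] (0 :: int)) x" using Bs by auto
    then show "x \<in> D" using \<open>x \<in> B\<close> unfolding D_def by blast
  qed
  moreover have "C \<inter> D = {}"
  proof -
    \<comment> \<open>With \<open>y = b^(m i) x\<close>, intertwining gives
      \<open>g y = b^(l i) (g x)\<close>. The hypothesis on \<open>A\<close> relates
      \<open>x\<close> to \<open>y\<close> and \<open>g x\<close> to \<open>g y\<close>; as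
      \<open>y\<close> is related to \<open>g y\<close>, \<open>x\<close> would be related to
      \<open>g x\<close>.\<close>
    have False if x: "x \<in> B" and y: "\<phi> ((b [^] m) [^] i) x \<in> C" for x and i :: int
    proof -
      let ?y = "\<phi> (b [^] (m * i)) x"
      have xs: "x \<in> space M" using x Bs by auto
      have y': "?y \<in> C" using y by (simp add: int_pow_pow)
      have "\<phi> g ?y = \<phi> (b [^] (l * i)) (\<phi> g x)"
        using intertwine_int_pow[OF _ _ _ comm, of i] xs
        by (simp add: int_pow_pow flip: act_mult)
      moreover have "\<phi> g x \<in> A" "\<phi> g ?y \<in> A"
        using x y' by (auto simp: B_def C_def)
      ultimately have "(\<phi> g x, \<phi> g ?y) \<in> r" using A by metis
      moreover have "(x, ?y) \<in> r"
        using x y' A by (auto simp: B_def C_def)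
      moreover have "(?y, \<phi> g ?y) \<in> r"
        using y' by (auto simp: C_def linked_def)
      ultimately have "(x, \<phi> g x) \<in> r" using r_sym r_trans by blast
      then show False using x xs by (auto simp: B_def linked_def)
    qed
    then show ?thesis by (auto simp: D_def)
  qed
  ultimately have "measure M B = 0 \<or> measure M C = 0"
  proof (elim disjE)
    assume "measure M D = 0"
    then have "measure M B = 0"
      using finite_measure_mono[of B D] \<open>B \<subseteq> D\<close> by (simp add: measure_le_0_iff)
    then show ?thesis ..
  next
    assume "measure M D = 1"
    have "measure M (C \<union> D) = measure M C + measure M D"
      using \<open>C \<inter> D = {}\<close> by (intro finite_measure_Union) auto
    then show ?thesis
      using prob_le_1[of "C \<union> D"] \<open>measure M D = 1\<close> measure_nonneg[of M C] by linarith
  qed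
  then show ?thesis by (auto simp: B_def C_def)
qed

end

section \<open>Approximations\<close>

context pmp_group_action
begin

text \<open>Turns the sequential definition into a finite test. Otherwise, counterexamples for the
  first \<open>n + 1\<close> terms of an enumeration of \<open>H\<close>, with tolerance
  \<open>1 / (n + 1)\<close>, would form an asymptotically invariant but not asymptotically trivial
  sequence.\<close>

lemma strongly_ergodic_uniform:
  assumes "countable H" "H \<noteq> {}" "strongly_ergodic_action (G\<lparr>carrier := H\<rparr>) M \<phi>" "\<eta> > 0"
  obtains F \<delta> where "finite F" "F \<subseteq> H" "\<delta> > 0"
    "\<And>A. A \<in> sets M \<Longrightarrow> (\<And>g. g \<in> F \<Longrightarrow> measure M (sym_diff A (\<phi> g ` A)) \<le> \<delta>) \<Longrightarrow>
      measure M A * (1 - measure M A) < \<eta>"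
proof (rule ccontr)
  assume neg: "\<not> thesis"
  let ?F = "\<lambda>n. from_nat_into H ` {..n}"
  have "\<exists>A\<in>sets M. (\<forall>g\<in>?F n. measure M (sym_diff A (\<phi> g ` A)) \<le> inverse (real (Suc n))) \<and>
      \<eta> \<le> measure M A * (1 - measure M A)" for n
  proof (rule ccontr)
    assume "\<not> ?thesis"
    moreover have "?F n \<subseteq> H" "finite (?F n)" "inverse (real (Suc n)) > 0"
      using from_nat_into[OF assms(2)] by auto
    ultimately show False
      using neg that[of "?F n" "inverse (real (Suc n))"] by (meson not_le)
  qed
  then obtain A where A: "\<And>n. A n \<in> sets M"
      "\<And>n g. g \<in> ?F n \<Longrightarrow> measure M (sym_diff (A n) (\<phi> g ` A n)) \<le> inverse (real (Suc n))"
      "\<And>n. \<eta> \<le> measure M (A n) * (1 - measure M (A n))"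
    by metis
  have "(\<lambda>n. measure M (sym_diff (A n) (\<phi> g ` A n))) \<longlonglongrightarrow> 0" if g: "g \<in> H" for g
  proof (rule tendsto_sandwich[OF _ _ tendsto_const LIMSEQ_inverse_real_of_nat])
    obtain k where k: "g = from_nat_into H k"
      using from_nat_into_surj[OF assms(1) g] by metis
    show "\<forall>\<^sub>F n in sequentially. measure M (sym_diff (A n) (\<phi> g ` A n)) \<le> inverse (real (Suc n))"
      using eventually_ge_at_top[of k] by eventually_elim (rule A(2), auto simp: k)
  qed simp
  then have "(\<lambda>n. measure M (A n) * (1 - measure M (A n))) \<longlonglongrightarrow> 0"
    using assms(3) A(1) by (simp add: strongly_ergodic_action_def)
  then have "\<eta> \<le> 0"
    by (rule tendsto_lowerbound) (use A(3) in auto)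
  then show False using assms(4) by simp
qed

lemma approximation_measurable_equiv_action:
  assumes "approximation M S R"
  shows "measurable_equiv_action M G \<phi> (R n)"
  using assms by unfold_locales (auto simp: approximation_def pmp_equiv_rel_def)

text \<open>Continuity of the measure from below, applied inside the conull set \<open>Z\<close>
  where both \<open>x\<close> and \<open>g x\<close> lie in \<open>Y\<close>: the \<open>R n\<close>
  are known to increase to the orbit relation only on \<open>Y\<close>.\<close>

lemma approximation_gap_tendsto_0:
  assumes appr: "approximation M (orbit_equiv_rel G M \<phi>) R" and g [measurable, simp]: "g \<in> carrier G"
  shows "(\<lambda>n. gap (R n) g) \<longlonglongrightarrow> 0"
proof -
  obtain Y where [measurable]: "Y \<in> sets M" and null: "space M - Y \<in> null_sets M"
    and mono: "\<And>n. Restr (R n) Y \<subseteq> Restr (R (Suc n)) Y"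
    and Un: "(\<Union>n. Restr (R n) Y) = Restr (orbit_equiv_rel G M \<phi>) Y"
    using appr by (auto simp: approximation_def)
  have Ys: "Y \<subseteq> space M" by (rule sets.sets_into_space) simp
  have Y1: "measure M Y = 1"
    using measure_eq_0_null_sets[OF null] by (simp add: prob_compl)
  define Z where "Z = Y \<inter> (\<phi> g -` Y \<inter> space M)"
  have [measurable]: "Z \<in> sets M" by (simp add: Z_def)
  have "measure M Z = 1"
  proof -
    have "space M - Z = (space M - Y) \<union> (\<phi> g -` (space M - Y) \<inter> space M)"
      by (auto simp: Z_def)
    also have "measure M \<dots> \<le> measure M (space M - Y) + measure M (\<phi> g -` (space M - Y) \<inter> space M)"
      by (intro measure_Un_le) auto
    also have "\<dots> = 0" using Y1 by (simp add: prob_compl)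
    finally show ?thesis using prob_le_1[of Z] by (simp add: prob_compl)
  qed
  have L [measurable]: "linked (R n) g \<in> sets M" for n
    using approximation_measurable_equiv_action[OF appr] g by (rule measurable_equiv_action.linked_sets)
  define E where "E n = linked (R n) g \<inter> Z" for n
  have E_iff: "x \<in> E n \<longleftrightarrow> x \<in> Z \<and> (x, \<phi> g x) \<in> Restr (R n) Y" for x n
    using Ys by (auto simp: E_def Z_def linked_def)
  have "(\<lambda>n. measure M (E n)) \<longlonglongrightarrow> measure M (\<Union>n. E n)"
  proof (rule finite_Lim_measure_incseq)
    show "incseq E"
      using mono by (intro incseq_SucI subsetI) (unfold E_iff, blast)
  qed (auto simp: E_def)
  also have "(\<Union>n. E n) = Z"
  proof -
    have "x \<in> (\<Union>n. E n)" if "x \<in> Z" for x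
    proof -
      have "(x, \<phi> g x) \<in> Restr (orbit_equiv_rel G M \<phi>) Y"
        using that by (auto simp: Z_def orbit_equiv_rel_def)
      then show ?thesis unfolding Un[symmetric] using that E_iff by blast
    qed
    then show ?thesis by (auto simp: E_def)
  qed
  finally have "(\<lambda>n. 1 - measure M (E n)) \<longlonglongrightarrow> 1 - 1"
    using \<open>measure M Z = 1\<close> by (intro tendsto_diff) auto
  moreover have "gap (R n) g \<le> 1 - measure M (E n)" for n
    using finite_measure_mono[of "E n" "linked (R n) g"] by (simp add: gap_def prob_compl E_def)
  ultimately show ?thesis
    by (intro tendsto_sandwich[of "\<lambda>_. 0" "\<lambda>n. gap (R n) g" sequentially "\<lambda>n. 1 - measure M (E n)"])
      (auto simp: gap_def intro!: always_eventually)
qed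

text \<open>Strong ergodicity keeps the gaps of the powers of \<open>b\<close> out of the interval
  above \<open>\<epsilon>\<close> up to \<open>1 / 2\<close>. Passing from \<open>b^j\<close> to
  \<open>b^(j+1)\<close> raises the gap by less than \<open>\<epsilon>\<close>, too little to jump
  across it.\<close>

lemma ex_power_uniformly_small_gap:
  assumes appr: "approximation M (orbit_equiv_rel G M \<phi>) R"
    and H: "countable H" "H \<noteq> {}" "H \<subseteq> carrier G" "strongly_ergodic_action (G\<lparr>carrier := H\<rparr>) M \<phi>"
    and a [simp]: "a \<in> carrier G"
    and comm: "\<And>g. g \<in> H \<Longrightarrow> \<exists>k :: int. k \<noteq> 0 \<and> g \<otimes> a [^] k = a [^] k \<otimes> g"
    and \<epsilon>: "0 < \<epsilon>" "\<epsilon> \<le> 1 / 4"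
  obtains k :: int where "k \<noteq> 0"
    "\<forall>\<^sub>F n in sequentially. \<forall>i :: int. gap (R n) ((a [^] k) [^] i) \<le> \<epsilon>"
proof -
  obtain F \<delta> where F: "finite F" "F \<subseteq> H" "\<delta> > 0"
    "\<And>A. A \<in> sets M \<Longrightarrow> (\<And>g. g \<in> F \<Longrightarrow> measure M (sym_diff A (\<phi> g ` A)) \<le> \<delta>) \<Longrightarrow>
      measure M A * (1 - measure M A) < \<epsilon> / 2"
    using strongly_ergodic_uniform[OF H(1,2,4), of "\<epsilon> / 2"] \<epsilon> by auto
  obtain \<kappa> :: "_ \<Rightarrow> int" where \<kappa>: "\<And>g. g \<in> F \<Longrightarrow> \<kappa> g \<noteq> 0 \<and> g \<otimes> a [^] \<kappa> g = a [^] \<kappa> g \<otimes> g"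
    using comm F(2) by (metis subsetD)
  \<comment> \<open>A common multiple of the exponents \<open>\<kappa> g\<close>, so that one power
    of \<open>a\<close> commutes with all of \<open>F\<close>.\<close>
  define k where "k = (\<Prod>g\<in>F. \<kappa> g)"
  have "k \<noteq> 0" using F(1) \<kappa> by (auto simp: k_def)
  define b where "b = a [^] k"
  have b [simp]: "b \<in> carrier G" by (simp add: b_def)
  have gb: "g \<otimes> b [^] i = b [^] i \<otimes> g" if "g \<in> F" for g and i :: int
  proof -
    have g: "g \<in> carrier G" using that F(2) H(3) by auto
    have "\<kappa> g dvd k" unfolding k_def using F(1) that by (rule dvd_prodI)
    then obtain c where "k = \<kappa> g * c" by (rule dvdE)
    then have "b [^] i = (a [^] \<kappa> g) [^] (c * i)"
      by (simp add: b_def int_pow_pow mult.assoc)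
    then show ?thesis
      using intertwine_int_pow[of g "a [^] \<kappa> g" "a [^] \<kappa> g" "c * i"] g \<kappa>[OF that] by simp
  qed
  have small: "\<forall>\<^sub>F n in sequentially. gap (R n) g < e" if "g \<in> carrier G" "e > 0" for g e
    using order_tendstoD(2)[OF approximation_gap_tendsto_0[OF appr that(1)] that(2)] .
  \<comment> \<open>The quotient \<open>\<delta> / 4\<close> matches the factor 4 in
    \<open>measure_sym_diff_act_linked\<close>.\<close>
  have "\<forall>\<^sub>F n in sequentially. \<forall>g\<in>F. gap (R n) g < \<delta> / 4"
    using F H(3) by (intro eventually_ball_finite ballI small) auto
  moreover have "\<forall>\<^sub>F n in sequentially. gap (R n) b < \<epsilon>"
    using \<epsilon> by (intro small) auto
  ultimately have "\<forall>\<^sub>F n in sequentially. \<forall>i :: int. gap (R n) (b [^] i) \<le> \<epsilon>"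
  proof eventually_elim
    case (elim n)
    interpret measurable_equiv_action M G \<phi> "R n"
      by (rule approximation_measurable_equiv_action[OF appr])
    \<comment> \<open>For the gap \<open>u\<close>, near invariance gives
      \<open>u (1 - u) < \<epsilon> / 2\<close>; if \<open>u \<le> 1 / 2\<close>, then
      \<open>1 - u \<ge> 1 / 2\<close> and so \<open>u < \<epsilon>\<close>.\<close>
    have dich: "gap (R n) (b [^] i) \<le> \<epsilon>" if "gap (R n) (b [^] i) \<le> 1 / 2" for i :: int
    proof -
      let ?L = "linked (R n) (b [^] i)"
      have "measure M (sym_diff ?L (\<phi> g ` ?L)) \<le> \<delta>" if "g \<in> F" for g
        using measure_sym_diff_act_linked[OF _ _ gb[OF that], of i] elim(1) F(2) H(3) that by force
      then have "measure M ?L * (1 - measure M ?L) < \<epsilon> / 2"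
        by (intro F(4)) auto
      then have "(1 - gap (R n) (b [^] i)) * gap (R n) (b [^] i) < \<epsilon> / 2"
        by (simp add: gap_eq)
      moreover have "1 / 2 * gap (R n) (b [^] i) \<le> (1 - gap (R n) (b [^] i)) * gap (R n) (b [^] i)"
        using that by (intro mult_right_mono) (auto simp: gap_def)
      ultimately show ?thesis by linarith
    qed
    \<comment> \<open>The next gap is at most \<open>2 * \<epsilon> \<le> 1 / 2\<close>, so
      \<open>dich\<close> brings it back to at most \<open>\<epsilon>\<close>.\<close>
    have nat: "gap (R n) (b [^] int j) \<le> \<epsilon>" for j
    proof (induction j)
      case (Suc j)
      have "b [^] int (Suc j) = b [^] int j \<otimes> b"
        by (simp only: int_pow_int nat_pow_Suc)
      then have "gap (R n) (b [^] int (Suc j)) \<le> gap (R n) (b [^] int j) + gap (R n) b"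
        using gap_mult[of "b [^] int j" b] by simp
      also have "\<dots> \<le> 1 / 2" using Suc.IH elim(2) \<epsilon> by simp
      finally show ?case by (rule dich)
    qed (use \<epsilon> in \<open>simp add: gap_one\<close>)
    show ?case
    proof
      fix i :: int
      show "gap (R n) (b [^] i) \<le> \<epsilon>"
      proof (cases i rule: int_cases2)
        case (nonpos j)
        then show ?thesis using nat[of j] gap_inv[of "b [^] int j"] by (simp add: int_pow_neg)
      qed (use nat in auto)
    qed
  qed
  then show thesis
    using that[of k] \<open>k \<noteq> 0\<close> by (simp add: b_def)
qed

text \<open>Isolates the group-theoretic input: \<open>H\<close> plays the role of \<open>N\<close>,
  and \<open>comm\<close> and strong ergodicity control the powers of \<open>a\<close>;
  \<open>commens\<close> and \<open>erg\<close> extend this control to all of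
  \<open>G\<close>.\<close>

lemma non_approximable_action_criterion:
  assumes count: "countable (carrier G)" and T: "finite T" "carrier G = generate G T"
    and H: "H \<noteq> {}" "H \<subseteq> carrier G" "strongly_ergodic_action (G\<lparr>carrier := H\<rparr>) M \<phi>"
    and a [simp]: "a \<in> carrier G"
    and comm: "\<And>g. g \<in> H \<Longrightarrow> \<exists>k :: int. k \<noteq> 0 \<and> g \<otimes> a [^] k = a [^] k \<otimes> g"
    and commens: "\<And>g. g \<in> carrier G \<Longrightarrow>
        \<exists>(m :: int) (l :: int). m \<noteq> 0 \<and> g \<otimes> a [^] m = a [^] l \<otimes> g"
    and erg: "\<And>k :: int. k \<noteq> 0 \<Longrightarrow> ergodic_action (subgroup_generated G {a [^] k}) M \<phi>"
  shows "non_approximable_action G M \<phi>"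
  unfolding non_approximable_action_def non_approximable_def
proof (intro allI impI)
  fix R assume appr: "approximation M (orbit_equiv_rel G M \<phi>) R"
  \<comment> \<open>The value \<open>1 / 100\<close> yields
    \<open>measure M A \<ge> 88 / 100\<close>, so the complement of \<open>A \<inter> g^-1 A\<close>
    has measure at most \<open>24 / 100\<close>. The threshold \<open>76 / 100\<close> used below is
    \<open>1 - 24 / 100\<close>, and it exceeds twice \<open>24 / 100\<close>.\<close>
  obtain k :: int where k: "k \<noteq> 0"
    "\<forall>\<^sub>F n in sequentially. \<forall>i :: int. gap (R n) ((a [^] k) [^] i) \<le> 1 / 100"
    using ex_power_uniformly_small_gap[OF appr countable_subset[OF H(2) count] H a comm, of "1 / 100"]
    by auto
  have TG: "T \<subseteq> carrier G"
    unfolding T(2) by (auto intro: generate.incl)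
  have "\<forall>\<^sub>F n in sequentially. \<forall>g\<in>T. gap (R n) g < 24 / 100"
    using TG
    by (intro eventually_ball_finite[OF T(1)] ballI order_tendstoD(2)[OF approximation_gap_tendsto_0[OF appr]]) auto
  from eventually_happens'[OF sequentially_bot eventually_conj[OF k(2) this]]
  obtain n where n: "\<And>i :: int. gap (R n) ((a [^] k) [^] i) \<le> 1 / 100"
    "\<And>g. g \<in> T \<Longrightarrow> gap (R n) g < 24 / 100" by blast
  interpret measurable_equiv_action M G \<phi> "R n"
    by (rule approximation_measurable_equiv_action[OF appr])
  define b where "b = a [^] k"
  have b [simp]: "b \<in> carrier G" by (simp add: b_def)
  obtain A where A [measurable, simp]: "A \<in> sets M" and A_large: "measure M A \<ge> 1 - 12 * (1 / 100)"
    and A_linked: "\<And>x i. x \<in> A \<Longrightarrow> \<phi> (b [^] (i :: int)) x \<in> A \<Longrightarrow> (x, \<phi> (b [^] i) x) \<in> R n"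
    using ex_large_powers_linked[OF b n(1)[folded b_def]] by metis
  have As: "A \<subseteq> space M" by (rule sets.sets_into_space) simp
  define B where "B g = A \<inter> \<phi> g -` A - linked (R n) g" for g
  define C where "C g = A \<inter> \<phi> g -` A \<inter> linked (R n) g" for g
  have V: "A \<inter> \<phi> g -` A = A \<inter> (\<phi> g -` A \<inter> space M)" for g
    using As by auto
  have BC [measurable]: "B g \<in> sets M" "C g \<in> sets M" if [measurable, simp]: "g \<in> carrier G" for g
    unfolding B_def C_def V by measurable
  have dich: "measure M (C g) = 0 \<or> measure M (B g) = 0" if g: "g \<in> carrier G" for g
  proof -
    obtain m l :: int where ml: "m \<noteq> 0" "g \<otimes> a [^] m = a [^] l \<otimes> g"
      using commens[OF g] by blast
    \<comment> \<open>Taking \<open>k\<close>-th powers of \<open>a^m\<close> and \<open>a^l\<close>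
      gives the same exponent pair for \<open>b\<close>.\<close>
    have "b [^] m = (a [^] m) [^] k" "b [^] l = (a [^] l) [^] k"
      by (simp_all add: b_def int_pow_pow mult.commute)
    then have "g \<otimes> b [^] m = b [^] l \<otimes> g"
      using intertwine_int_pow[OF g _ _ ml(2), of k] by simp
    moreover have "ergodic_action (subgroup_generated G {b [^] m}) M \<phi>"
      using erg[of "k * m"] k(1) ml(1) by (simp add: b_def int_pow_pow)
    ultimately show ?thesis
      unfolding B_def C_def using linked_dichotomy[OF g b A A_linked] by blast
  qed
  have compl: "measure M (space M - A \<inter> \<phi> g -` A) \<le> 24 / 100" if [measurable, simp]: "g \<in> carrier G" for g
  proof -
    have "space M - A \<inter> \<phi> g -` A = (space M - A) \<union> (\<phi> g -` (space M - A) \<inter> space M)"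
      by auto
    also have "measure M \<dots> \<le> measure M (space M - A) + measure M (\<phi> g -` (space M - A) \<inter> space M)"
      by (intro measure_Un_le) auto
    also have "\<dots> = 2 * measure M (space M - A)" by simp
    also have "\<dots> \<le> 24 / 100" using A_large by (simp add: prob_compl)
    finally show ?thesis .
  qed
  have compl_sets [measurable]: "space M - A \<inter> \<phi> g -` A \<in> sets M" if [measurable, simp]: "g \<in> carrier G" for g
    unfolding V by measurable
  \<comment> \<open>Otherwise \<open>C g\<close> is null by \<open>dich\<close>, so almost all
    linked points lie outside \<open>A \<inter> g^-1 A\<close>, and the gap is at least
    \<open>76 / 100\<close>.\<close>
  have B_null: "measure M (B g) = 0" if g [measurable, simp]: "g \<in> carrier G" and gap: "gap (R n) g < 76 / 100" for g
  proof (rule ccontr)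
    assume "measure M (B g) \<noteq> 0"
    with dich[OF g] have C: "measure M (C g) = 0" by blast
    have "measure M (linked (R n) g) \<le> measure M (C g \<union> (space M - A \<inter> \<phi> g -` A))"
      using BC compl_sets g linked_subset_space by (intro finite_measure_mono) (auto simp: C_def)
    also have "\<dots> \<le> measure M (C g) + measure M (space M - A \<inter> \<phi> g -` A)"
      using BC compl_sets g by (intro measure_Un_le)
    also have "\<dots> \<le> 24 / 100" using C compl[OF g] by simp
    finally show False using gap by (simp add: gap_eq)
  qed
  have improve: "gap (R n) g \<le> 24 / 100" if g [measurable, simp]: "g \<in> carrier G" and gap: "gap (R n) g < 76 / 100" for g
  proof -
    have "gap (R n) g \<le> measure M (B g \<union> (space M - A \<inter> \<phi> g -` A))"
      unfolding gap_def using BC compl_sets g by (intro finite_measure_mono) (auto simp: B_def)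
    also have "\<dots> \<le> measure M (B g) + measure M (space M - A \<inter> \<phi> g -` A)"
      using BC compl_sets g by (intro measure_Un_le)
    also have "\<dots> \<le> 24 / 100" using B_null[OF g gap] compl[OF g] by simp
    finally show ?thesis .
  qed
  \<comment> \<open>Two gaps of at most \<open>24 / 100\<close> add up to less than
    \<open>76 / 100\<close>, and \<open>improve\<close> restores the bound for the product; so it
    spreads from the generators to the whole group without loss.\<close>
  have all: "gap (R n) g \<le> 24 / 100" if "g \<in> carrier G" for g
    using that unfolding T(2)
  proof (induction rule: generate.induct)
    case one
    show ?case by (simp add: gap_one)
  next
    case (incl h)
    then show ?case using n(2) by fastforce
  next
    case (inv h)
    then show ?case using n(2)[of h] TG gap_inv[of h] by auto
  next
    case (eng h1 h2)
    have [simp]: "h1 \<in> carrier G" "h2 \<in> carrier G"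
      using eng unfolding T(2) by auto
    have "gap (R n) (h1 \<otimes> h2) \<le> gap (R n) h1 + gap (R n) h2"
      by (rule gap_mult) simp_all
    then show ?case using eng.IH by (intro improve) auto
  qed
  have null: "(\<Union>g\<in>carrier G. B g) \<in> null_sets M"
  proof (rule null_sets_UN'[OF count])
    fix g assume g: "g \<in> carrier G"
    have "measure M (B g) = 0" using all[OF g] by (intro B_null g) simp
    then show "B g \<in> null_sets M"
      using BC(1)[OF g] by (simp add: null_sets_def emeasure_eq_measure)
  qed
  obtain Y where Y [measurable]: "Y \<in> sets M" and Y_null: "space M - Y \<in> null_sets M"
    and Un: "(\<Union>n. Restr (R n) Y) = Restr (orbit_equiv_rel G M \<phi>) Y"
    using appr by (auto simp: approximation_def)
  have N: "(\<Union>g\<in>carrier G. B g) \<union> (space M - Y) \<in> null_sets M"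
    using null Y_null by (rule null_sets.Un)
  \<comment> \<open>Besides the null sets \<open>B g\<close>, the complement of \<open>Y\<close> is
    removed, because \<open>R n\<close> is known to lie in the orbit relation only on
    \<open>Y\<close>.\<close>
  define D where "D = A - ((\<Union>g\<in>carrier G. B g) \<union> (space M - Y))"
  have D: "D \<in> sets M" "D \<subseteq> A" "D \<subseteq> Y"
    using N A As by (auto simp: D_def)
  show "trivial_approximation M (orbit_equiv_rel G M \<phi>) R"
    unfolding trivial_approximation_def
  proof (intro exI bexI conjI)
    show "D \<in> sets M" by fact
    show "emeasure M D > 0"
      using A_large measure_Diff_null_set[OF A N] by (simp add: D_def emeasure_eq_measure)
    show "Restr (R n) D = Restr (orbit_equiv_rel G M \<phi>) D"
    proof
      show "Restr (R n) D \<subseteq> Restr (orbit_equiv_rel G M \<phi>) D"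
        using Un D(3) by blast
      show "Restr (orbit_equiv_rel G M \<phi>) D \<subseteq> Restr (R n) D"
      proof
        fix z assume "z \<in> Restr (orbit_equiv_rel G M \<phi>) D"
        then obtain x g where z: "z = (x, \<phi> g x)" "x \<in> D" "\<phi> g x \<in> D" and g: "g \<in> carrier G"
          by (auto simp: orbit_equiv_rel_def)
        have "x \<notin> B g" using z(2) g by (auto simp: D_def)
        then have "x \<in> linked (R n) g" using z D(2) by (auto simp: B_def)
        then show "z \<in> Restr (R n) D" using z by (auto simp: linked_def)
      qed
    qed
  qed
qed

end

section \<open>Baumslag--Solitar groups\<close>

lemma presented_group_inv_generator:
  "inv\<^bsub>presented_group E\<^esub> pres_class E [(x, True)] = pres_class E [(x, False)]"
proof -
  interpret group "presented_group E" by (rule group_presented_group)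
  have "pres_class E [(x, False)] \<otimes>\<^bsub>presented_group E\<^esub> pres_class E [(x, True)] = pres_class E []"
    using pres_eq.cancel[of E x False] by (simp only: presented_group_mult pres_class_eq_iff) simp
  then show ?thesis
    by (intro inv_equality) (auto simp: presented_group_def)
qed

lemma word_int_pow_class:
  "pres_class E (word_int_pow x k) = pres_class E [(x, True)] [^]\<^bsub>presented_group E\<^esub> k"
proof -
  interpret group "presented_group E" by (rule group_presented_group)
  let ?c = "\<lambda>b. pres_class E [(x, b)]"
  have carr: "?c b \<in> carrier (presented_group E)" for b
    by (simp add: presented_group_def)
  have one: "\<one>\<^bsub>presented_group E\<^esub> = pres_class E []"
    by (simp add: presented_group_def)
  have rep: "pres_class E (replicate n (x, b)) = ?c b [^]\<^bsub>presented_group E\<^esub> n" for n b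
  proof (induction n)
    case (Suc n)
    have "pres_class E (replicate (Suc n) (x, b)) = pres_class E (replicate n (x, b)) \<otimes>\<^bsub>presented_group E\<^esub> ?c b"
      by (simp add: presented_group_mult replicate_append_same)
    then show ?case by (simp add: Suc.IH)
  qed (simp add: one)
  show ?thesis
  proof (cases "0 \<le> k")
    case True
    then show ?thesis by (simp add: word_int_pow_def rep pow_nat)
  next
    case False
    then have "?c True [^]\<^bsub>presented_group E\<^esub> k = inv\<^bsub>presented_group E\<^esub> (?c True [^]\<^bsub>presented_group E\<^esub> nat (- k))"
      by (simp only: int_pow_def2 not_le if_True)
    also have "\<dots> = ?c False [^]\<^bsub>presented_group E\<^esub> nat (- k)"
      by (simp only: presented_group_inv_generator flip: nat_pow_inv[OF carr])
    finally show ?thesis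
      using False by (simp add: word_int_pow_def rep)
  qed
qed

lemma BS_relation:
  "bs_t p q \<otimes>\<^bsub>BS p q\<^esub> bs_a p q [^]\<^bsub>BS p q\<^esub> p = bs_a p q [^]\<^bsub>BS p q\<^esub> q \<otimes>\<^bsub>BS p q\<^esub> bs_t p q"
proof -
  let ?E = "bs_relations p q"
  let ?t = "\<lambda>b. [(Gen_t, b)]"
  have "pres_eq ?E ((?t True @ word_int_pow Gen_a p @ ?t False) @ ?t True) (word_int_pow Gen_a q @ ?t True)"
    by (intro pres_eq.append pres_eq.rel pres_eq.refl) (simp add: bs_relations_def)
  then have "pres_eq ?E (?t True @ word_int_pow Gen_a p @ ?t False @ ?t True) (word_int_pow Gen_a q @ ?t True)"
    by simp
  moreover have "pres_eq ?E ((?t True @ word_int_pow Gen_a p) @ ?t False @ ?t True) ((?t True @ word_int_pow Gen_a p) @ [])"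
    using pres_eq.cancel[of ?E Gen_t False] by (intro pres_eq.append pres_eq.refl) simp
  then have "pres_eq ?E (?t True @ word_int_pow Gen_a p) (?t True @ word_int_pow Gen_a p @ ?t False @ ?t True)"
    by (intro pres_eq.sym[of _ "?t True @ word_int_pow Gen_a p @ ?t False @ ?t True"]) simp
  ultimately have "pres_eq ?E (?t True @ word_int_pow Gen_a p) (word_int_pow Gen_a q @ ?t True)"
    by (blast intro: pres_eq.trans)
  then show ?thesis
    by (simp add: BS_def bs_a_def bs_t_def presented_group_mult pres_class_eq_iff flip: word_int_pow_class)
qed

section \<open>Generation and commensuration of the powers of \<open>a\<close>\<close>

lemma group_BS: "group (BS p q)"
  by (simp add: BS_def group_presented_group)

lemma bs_a_closed: "bs_a p q \<in> carrier (BS p q)" and bs_t_closed: "bs_t p q \<in> carrier (BS p q)"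
  by (simp_all add: BS_def presented_group_def bs_a_def bs_t_def)

lemma countable_carrier_BS: "countable (carrier (BS p q))"
proof -
  have "(UNIV :: bs_gen set) = {Gen_a, Gen_t}"
    by (auto intro: bs_gen.exhaust)
  then have "finite (UNIV :: bs_gen set)"
    by (metis finite.emptyI finite.insertI)
  then have "countable (UNIV :: (bs_gen \<times> bool) set)"
    unfolding UNIV_Times_UNIV[symmetric] by (intro countable_SIGMA countable_finite) auto
  then have "countable (UNIV :: bs_gen word set)"
    using countable_lists[of "UNIV :: (bs_gen \<times> bool) set"] by simp
  then show ?thesis by (simp add: BS_def presented_group_def)
qed

text \<open>Induction along a representing word: prepending a letter is left multiplication by a
  generator or its inverse.\<close>

lemma BS_word_induct [consumes 1, case_names one a a_inv t t_inv]:
  assumes "g \<in> carrier (BS p q)"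
    and one: "P \<one>\<^bsub>BS p q\<^esub>"
    and step: "\<And>g. g \<in> carrier (BS p q) \<Longrightarrow> P g \<Longrightarrow> P (bs_a p q \<otimes>\<^bsub>BS p q\<^esub> g)"
      "\<And>g. g \<in> carrier (BS p q) \<Longrightarrow> P g \<Longrightarrow> P (inv\<^bsub>BS p q\<^esub> bs_a p q \<otimes>\<^bsub>BS p q\<^esub> g)"
      "\<And>g. g \<in> carrier (BS p q) \<Longrightarrow> P g \<Longrightarrow> P (bs_t p q \<otimes>\<^bsub>BS p q\<^esub> g)"
      "\<And>g. g \<in> carrier (BS p q) \<Longrightarrow> P g \<Longrightarrow> P (inv\<^bsub>BS p q\<^esub> bs_t p q \<otimes>\<^bsub>BS p q\<^esub> g)"
  shows "P g"
proof -
  interpret group "BS p q" by (rule group_BS)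
  let ?E = "bs_relations p q"
  have carr: "carrier (BS p q) = range (pres_class ?E)" and
    one': "\<one>\<^bsub>BS p q\<^esub> = pres_class ?E []" 
    by (simp_all add: BS_def presented_group_def)
  have inv: "inv\<^bsub>BS p q\<^esub> pres_class ?E [(x, True)] = pres_class ?E [(x, False)]" for x
    by (simp add: BS_def presented_group_inv_generator)
  have "P (pres_class ?E u)" for u
  proof (induction u)
    case Nil
    then show ?case using one by (simp add: one')
  next
    case (Cons y u)
    obtain x b where y: "y = (x, b)" by force
    have "pres_class ?E (y # u) = pres_class ?E [(x, b)] \<otimes>\<^bsub>BS p q\<^esub> pres_class ?E u"
      by (simp add: BS_def presented_group_mult y)
    then show ?case
      using step[OF _ Cons.IH] inv[of x] by (cases x; cases b) (auto simp: bs_a_def bs_t_def carr)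
  qed
  then show ?thesis using assms(1) by (auto simp: carr)
qed

lemma generate_BS: "carrier (BS p q) = generate (BS p q) {bs_a p q, bs_t p q}"
proof -
  interpret group "BS p q" by (rule group_BS)
  have "g \<in> generate (BS p q) {bs_a p q, bs_t p q}" if "g \<in> carrier (BS p q)" for g
    using that by (induction rule: BS_word_induct) (auto intro: generate.intros)
  then show ?thesis
    using generate_in_carrier[of "{bs_a p q, bs_t p q}"] bs_a_closed bs_t_closed by blast
qed

text \<open>The quotient \<open>m / l\<close> is the modular value of \<open>g\<close>; on the
  kernel this forces \<open>m = l\<close>, so \<open>g\<close> commutes with \<open>a^m\<close>. The
  pairs \<open>(m, l)\<close> start with \<open>(1, 1)\<close> for \<open>a\<close> and
  \<open>(p, q)\<close> for \<open>t\<close>, multiply under products and swap under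
  inverses.\<close>

lemma BS_commensurates_powers:
  assumes pq: "p \<noteq> 0" "q \<noteq> 0" and "g \<in> carrier (BS p q)"
  shows "\<exists>m l. m \<noteq> 0 \<and> of_int l * bs_modular p q g = of_int m \<and>
    g \<otimes>\<^bsub>BS p q\<^esub> bs_a p q [^]\<^bsub>BS p q\<^esub> m = bs_a p q [^]\<^bsub>BS p q\<^esub> l \<otimes>\<^bsub>BS p q\<^esub> g"
proof -
  interpret group "BS p q" by (rule group_BS)
  note [simp] = bs_a_closed[of p q] bs_t_closed[of p q]
  let ?P = "\<lambda>g m l. m \<noteq> 0 \<and> of_int l * bs_modular p q g = of_int m \<and>
    g \<otimes>\<^bsub>BS p q\<^esub> bs_a p q [^]\<^bsub>BS p q\<^esub> m = bs_a p q [^]\<^bsub>BS p q\<^esub> l \<otimes>\<^bsub>BS p q\<^esub> g"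
  have mult_hom: "bs_modular p q (g \<otimes>\<^bsub>BS p q\<^esub> h) = bs_modular p q g * bs_modular p q h"
    if "g \<in> carrier (BS p q)" "h \<in> carrier (BS p q)" for g h
    using bs_modular_hom[OF pq] that by (auto simp: hom_def rat_units_def)
  have mod1: "bs_modular p q \<one>\<^bsub>BS p q\<^esub> = 1"
    using bs_modular_class[OF pq, of "[]"] by (simp add: BS_def presented_group_def bs_modular_word_def)
  have P_mult: "\<exists>m l. ?P (g \<otimes>\<^bsub>BS p q\<^esub> h) m l"
    if [simp]: "g \<in> carrier (BS p q)" "h \<in> carrier (BS p q)" and g: "?P g m l" and h: "?P h m' l'" for g h m l m' l'
  proof (intro exI conjI)
    let ?a = "bs_a p q"
    show "m' * m \<noteq> 0" using g h by simp
    show "of_int (l * l') * bs_modular p q (g \<otimes>\<^bsub>BS p q\<^esub> h) = of_int (m' * m)"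
    proof -
      have "of_int (l * l') * bs_modular p q (g \<otimes>\<^bsub>BS p q\<^esub> h)
          = (of_int l' * bs_modular p q h) * (of_int l * bs_modular p q g)"
        by (simp add: mult_hom mult_ac)
      also have "\<dots> = of_int m' * of_int m"
        using g h by (simp only:)
      finally show ?thesis by (simp only: of_int_mult)
    qed
    \<comment> \<open>The common middle exponent is \<open>l' * m\<close>: conjugation by
      \<open>h\<close> takes \<open>a^(m' m)\<close> to \<open>a^(l' m)\<close>, and conjugation by
      \<open>g\<close> takes this to \<open>a^(l l')\<close>.\<close>
    have 1: "h \<otimes>\<^bsub>BS p q\<^esub> ?a [^]\<^bsub>BS p q\<^esub> (m' * m) = ?a [^]\<^bsub>BS p q\<^esub> (l' * m) \<otimes>\<^bsub>BS p q\<^esub> h"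
      using intertwine_int_pow[of h "?a [^]\<^bsub>BS p q\<^esub> m'" "?a [^]\<^bsub>BS p q\<^esub> l'" m] h by (simp add: int_pow_pow)
    have 2: "g \<otimes>\<^bsub>BS p q\<^esub> ?a [^]\<^bsub>BS p q\<^esub> (l' * m) = ?a [^]\<^bsub>BS p q\<^esub> (l * l') \<otimes>\<^bsub>BS p q\<^esub> g"
      using intertwine_int_pow[of g "?a [^]\<^bsub>BS p q\<^esub> m" "?a [^]\<^bsub>BS p q\<^esub> l" l'] g by (simp add: int_pow_pow mult.commute)
    have "g \<otimes>\<^bsub>BS p q\<^esub> h \<otimes>\<^bsub>BS p q\<^esub> ?a [^]\<^bsub>BS p q\<^esub> (m' * m) = g \<otimes>\<^bsub>BS p q\<^esub> ?a [^]\<^bsub>BS p q\<^esub> (l' * m) \<otimes>\<^bsub>BS p q\<^esub> h"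
      using 1 by (simp add: m_assoc)
    then show "g \<otimes>\<^bsub>BS p q\<^esub> h \<otimes>\<^bsub>BS p q\<^esub> ?a [^]\<^bsub>BS p q\<^esub> (m' * m) = ?a [^]\<^bsub>BS p q\<^esub> (l * l') \<otimes>\<^bsub>BS p q\<^esub> (g \<otimes>\<^bsub>BS p q\<^esub> h)"
      unfolding 2 by (simp add: m_assoc)
  qed
  have P_inv: "?P (inv\<^bsub>BS p q\<^esub> g) l m" if [simp]: "g \<in> carrier (BS p q)" and g: "?P g m l" for g m l
  proof -
    let ?a = "bs_a p q"
    have "bs_modular p q g * bs_modular p q (inv\<^bsub>BS p q\<^esub> g) = 1"
      using mult_hom[of g "inv\<^bsub>BS p q\<^esub> g"] mod1 by simp
    moreover have "of_int l * (bs_modular p q g * bs_modular p q (inv\<^bsub>BS p q\<^esub> g)) = of_int m * bs_modular p q (inv\<^bsub>BS p q\<^esub> g)"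
      using g by (simp flip: mult.assoc)
    moreover have "l \<noteq> 0" using g by auto
    moreover have "inv\<^bsub>BS p q\<^esub> g \<otimes>\<^bsub>BS p q\<^esub> ?a [^]\<^bsub>BS p q\<^esub> l = ?a [^]\<^bsub>BS p q\<^esub> m \<otimes>\<^bsub>BS p q\<^esub> inv\<^bsub>BS p q\<^esub> g"
    proof -
      have "?a [^]\<^bsub>BS p q\<^esub> l = g \<otimes>\<^bsub>BS p q\<^esub> ?a [^]\<^bsub>BS p q\<^esub> m \<otimes>\<^bsub>BS p q\<^esub> inv\<^bsub>BS p q\<^esub> g"
        using g by (simp add: m_assoc)
      then show ?thesis by (simp flip: m_assoc)
    qed
    ultimately show ?thesis by simp
  qed
  have Pa: "?P (bs_a p q) 1 1"
    using bs_modular_generators[OF pq] by simp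
  have Pt: "?P (bs_t p q) p q"
    using bs_modular_generators[OF pq] BS_relation pq by simp
  show ?thesis using assms(3)
  proof (induction rule: BS_word_induct)
    case one
    show ?case by (intro exI[of _ 1]) (simp add: mod1)
  next
    case (a g)
    then show ?case using P_mult[OF _ _ Pa] by auto
  next
    case (a_inv g)
    then show ?case using P_mult[OF _ _ P_inv[OF _ Pa]] by auto
  next
    case (t g)
    then show ?case using P_mult[OF _ _ Pt] by auto
  next
    case (t_inv g)
    then show ?case using P_mult[OF _ _ P_inv[OF _ Pt]] by auto
  qed
qed

theorem theorem3p2:
  fixes p q :: int
    and M :: "'x measure"
    and \<phi> :: "bs_gen word set \<Rightarrow> 'x \<Rightarrow> 'x"
  assumes "p \<noteq> 0" and "q \<noteq> 0"
    and "standard_borel M" and "prob_space M" and "atomless M"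
    and "pmp_action (BS p q) M \<phi>"
    and "free_action (BS p q) M \<phi>"
    and "strongly_ergodic_action ((BS p q)\<lparr>carrier := bs_modular_kernel p q\<rparr>) M \<phi>"
    and "\<And>k :: int. k \<noteq> 0 \<Longrightarrow>
           ergodic_action (subgroup_generated (BS p q) {bs_a p q [^]\<^bsub>BS p q\<^esub> k}) M \<phi>"
  shows "non_approximable_action (BS p q) M \<phi>"
proof -
  interpret prob_space M by fact
  interpret group "BS p q" by (rule group_BS)
  interpret pmp_group_action M "BS p q" \<phi>
    by unfold_locales fact
  have kernel: "bs_modular_kernel p q = {g \<in> carrier (BS p q). bs_modular p q g = 1}"
    by (simp add: bs_modular_kernel_def kernel_def rat_units_def)
  have "bs_a p q \<in> bs_modular_kernel p q"
    using assms(1,2) by (simp add: kernel bs_a_closed bs_modular_generators)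
  then have "bs_modular_kernel p q \<noteq> {}" by blast
  moreover have "bs_modular_kernel p q \<subseteq> carrier (BS p q)"
    by (auto simp: kernel)
  moreover have "\<exists>k :: int. k \<noteq> 0 \<and>
      g \<otimes>\<^bsub>BS p q\<^esub> bs_a p q [^]\<^bsub>BS p q\<^esub> k = bs_a p q [^]\<^bsub>BS p q\<^esub> k \<otimes>\<^bsub>BS p q\<^esub> g"
    if "g \<in> bs_modular_kernel p q" for g
    using BS_commensurates_powers[OF assms(1,2), of g] that by (auto simp: kernel)
  moreover have "\<exists>(m :: int) (l :: int). m \<noteq> 0 \<and>
      g \<otimes>\<^bsub>BS p q\<^esub> bs_a p q [^]\<^bsub>BS p q\<^esub> m = bs_a p q [^]\<^bsub>BS p q\<^esub> l \<otimes>\<^bsub>BS p q\<^esub> g"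
    if "g \<in> carrier (BS p q)" for g
    using BS_commensurates_powers[OF assms(1,2) that] by blast
  ultimately show ?thesis
    by (intro non_approximable_action_criterion[OF countable_carrier_BS _ generate_BS _ _ assms(8) bs_a_closed]
        assms(9)) auto
qed

end
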